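(* Let $P\in\mathcal{P}(\mathbb{X})$, let $X_1,X_2,\dots$ be i.i.d. $\mathbb{X}$-valued random variables with law $P$, and let $P_n(B)=\frac1n\sum_{i=1}^n1_{\{X_i\in B\}}$ ($B\subset\mathbb{X}$ Borel) be the empirical measures. Suppose one of the following conditions holds: (i) the cost function $c:\mathbb{X}\times\mathbb{U}\to\mathbb{R}$ is non-negative, bounded and continuous on $\mathbb{X}\times\mathbb{U}$, $\mathbb{U}$ is compact, and the channel $Q$ is continuous in total variation (i.e. $\|Q(\cdot|x_n)-Q(\cdot|x)\|_{TV}\to0$ whenever $x_n\to x$); here the class of policies is $\mathcal{G}=\Gamma$; (ii) the class of policies is restricted to $\mathcal{G}=\{\gamma\in\Gamma:\ x\mapsto\int Q(dy|x)c(x,\gamma(y))\ \text{belongs to}\ \mathcal{E}\}$, where $\mathcal{E}$ is a $P$-Glivenko–Cantelli class of functions on $\mathbb{X}$; (iii) the class of policies is restricted to $\mathcal{G}=\{\gamma\in\Gamma:\ (x,y)\mapsto c(x,\gamma(y))\ \text{belongs to}\ \mathcal{E}\}$, where $\mathcal{E}$ is a $PQ$-uniformity class of functions on $\mathbb{X}\times\mathbb{Y}$, and $Q(\cdot|x)$ is weakly continuous in $x$. Let $J^*(P',Q)=\inf_{\gamma\in\mathcal{G}}J(P',Q,\gamma)$ and let $\gamma_n^*\in\mathcal{G}$ be an optimal policy for the estimated prior $P_n$, i.e. $J(P_n,Q,\gamma_n^* )=J^*(P_n,Q)$. Then, with probability $1$, as $n\to\infty$, $$J^*(P_n,Q)\to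 J^*(P,Q)\qquad\text{and}\qquad J(P,Q,\gamma_n^* )\to J^*(P,Q).$$
   Context: $\mathbb{X}\subset\mathbb{R}^n$, $\mathbb{Y}\subset\mathbb{R}^m$ and $\mathbb{U}$ (a subset of some Euclidean space) are Borel sets; $\mathcal{P}(\mathbb{X})$ is the set of Borel probability measures on $\mathbb{X}$. A channel $Q$ is a stochastic kernel from $\mathbb{X}$ to $\mathbb{Y}$; it is weakly continuous in $x$ if $x\mapsto\int g(y)Q(dy|x)$ is continuous for every bounded continuous $g$. $\Gamma$ is the set of Borel measurable functions $\gamma:\mathbb{Y}\to\mathbb{U}$; $c:\mathbb{X}\times\mathbb{U}\to\mathbb{R}$ is Borel measurable and $J(P',Q,\gamma)=\int_{\mathbb{X}}\int_{\mathbb{Y}}c(x,\gamma(y))Q(dy|x)P'(dx)$. $PQ$ denotes the joint law $PQ(A)=\int_AQ(dy|x)P(dx)$ on $\mathbb{X}\times\mathbb{Y}$. $\|\mu-\nu\|_{TV}=2\sup_B|\mu(B)-\nu(B)|$ over Borel sets $B$. A class $\mathcal{F}$ of measurable ($\mu$-integrable) functions is $\mu$-Glivenko–Cantelli if, for $\mu_n$ the empirical measures of an i.i.d. sequence with law $\mu$, almost surely $\lim_{n\to\infty}\sup_{f\in\mathcal{F}}|\int f\,d\mu_n-\int f\,d\mu|=0$. A class $\mathcal{F}$ is a $\mu$-uniformity class if $\lim_{n\to\infty}\sup_{f\in\mathcal{F}}|\int f\,d\mu_n-\int f\,d\mu|=0$ for every sequence of probability measures $\mu_n$ converging weakly to $\mu$.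 *)

theory Defs
  imports "HOL-Probability.Probability"
begin

text \<open>
  A subset \<open>S\<close> of a Euclidean space carries the trace Borel sigma-algebra. The Borel probability
  measures on \<open>S\<close> are \<open>space (prob_algebra (borel_on S))\<close>, and the stochastic kernels from \<open>X\<close> to
  \<open>Y\<close> are \<open>borel_on X \<rightarrow>\<^sub>M prob_algebra (borel_on Y)\<close>. Functions on \<open>S\<close> are represented by total
  functions, of which only the values on \<open>S\<close> matter.
\<close>

abbreviation borel_on :: "'a::topological_space set \<Rightarrow> 'a measure" where
  "borel_on S \<equiv> restrict_space borel S"

definition policies ::
    "'b::euclidean_space set \<Rightarrow> 'u::euclidean_space set \<Rightarrow> ('b \<Rightarrow> 'u) set" where
  "policies Y U = borel_on Y \<rightarrow>\<^sub>M borel_on U"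

definition cost ::
    "('a \<times> 'u \<Rightarrow> real) \<Rightarrow> 'a measure \<Rightarrow> ('a \<Rightarrow> 'b measure) \<Rightarrow> ('b \<Rightarrow> 'u) \<Rightarrow> real" where
  "cost c P Q \<gamma> = (\<integral>x. (\<integral>y. c (x, \<gamma> y) \<partial>Q x) \<partial>P)"

text \<open>
  The infimum is taken in the extended reals, where it exists for every policy class: under the
  Glivenko-Cantelli assumption alone the costs need not be bounded below.
\<close>

definition opt_cost ::
    "('b \<Rightarrow> 'u) set \<Rightarrow> ('a \<times> 'u \<Rightarrow> real) \<Rightarrow> 'a measure \<Rightarrow> ('a \<Rightarrow> 'b measure) \<Rightarrow> ereal" where
  "opt_cost G c P Q = (INF \<gamma>\<in>G. ereal (cost c P Q \<gamma>))"

definition optimal_policy ::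
    "('b \<Rightarrow> 'u) set \<Rightarrow> ('a \<times> 'u \<Rightarrow> real) \<Rightarrow> 'a measure \<Rightarrow> ('a \<Rightarrow> 'b measure) \<Rightarrow> ('b \<Rightarrow> 'u) \<Rightarrow> bool" where
  "optimal_policy G c P Q \<gamma> \<longleftrightarrow> \<gamma> \<in> G \<and> ereal (cost c P Q \<gamma>) = opt_cost G c P Q"

definition joint_law ::
    "'a::euclidean_space set \<Rightarrow> 'b::euclidean_space set \<Rightarrow> 'a measure \<Rightarrow> ('a \<Rightarrow> 'b measure) \<Rightarrow>
      ('a \<times> 'b) measure" where
  "joint_law X Y P Q = P \<bind> (\<lambda>x. distr (Q x) (borel_on (X \<times> Y)) (Pair x))"

lemma joint_law_kernel:
  fixes X :: "'a::euclidean_space set" and Y :: "'b::euclidean_space set"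
  assumes Q: "Q \<in> borel_on X \<rightarrow>\<^sub>M prob_algebra (borel_on Y)"
  shows "(\<lambda>x. distr (Q x) (borel_on (X \<times> Y)) (Pair x))
    \<in> borel_on X \<rightarrow>\<^sub>M prob_algebra (borel_on (X \<times> Y))"
proof (rule measurable_distr_prob_space2[OF Q])
  have fst: "fst \<in> borel_on X \<Otimes>\<^sub>M borel_on Y \<rightarrow>\<^sub>M borel"
    by (rule measurable_compose[OF measurable_fst]) (simp add: measurable_restrict_space1)
  have snd: "snd \<in> borel_on X \<Otimes>\<^sub>M borel_on Y \<rightarrow>\<^sub>M borel"
    by (rule measurable_compose[OF measurable_snd]) (simp add: measurable_restrict_space1)
  have "case_prod Pair \<in> borel_on X \<Otimes>\<^sub>M borel_on Y \<rightarrow>\<^sub>M borel"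
    using borel_measurable_Pair[OF fst snd] by (simp add: case_prod_unfold)
  then show "case_prod Pair \<in> borel_on X \<Otimes>\<^sub>M borel_on Y \<rightarrow>\<^sub>M borel_on (X \<times> Y)"
    by (intro measurable_restrict_space2) (auto simp: space_pair_measure space_restrict_space)
qed

lemma emeasure_joint_law:
  assumes P: "P \<in> space (prob_algebra (borel_on X))"
    and Q: "Q \<in> borel_on X \<rightarrow>\<^sub>M prob_algebra (borel_on Y)"
    and A: "A \<in> sets (borel_on (X \<times> Y))"
  shows "emeasure (joint_law X Y P Q) A = (\<integral>\<^sup>+x. emeasure (Q x) {y \<in> Y. (x, y) \<in> A} \<partial>P)"
proof -
  have sP: "space P = X" "sets P = sets (borel_on X)"
    using P by (auto simp: space_prob_algebra space_restrict_space dest: sets_eq_imp_space_eq)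
  have "emeasure (distr (Q x) (borel_on (X \<times> Y)) (Pair x)) A = emeasure (Q x) {y \<in> Y. (x, y) \<in> A}"
    if "x \<in> X" for x
  proof -
    have Qx: "sets (Q x) = sets (borel_on Y)"
      using measurable_space[OF Q, of x] that by (simp add: space_prob_algebra space_restrict_space)
    then have "space (Q x) = Y"
      by (auto simp: space_restrict_space dest: sets_eq_imp_space_eq)
    moreover have "Pair x \<in> borel_on Y \<rightarrow>\<^sub>M borel_on (X \<times> Y)"
      using that by (intro measurable_restrict_space2 measurable_restrict_space1)
        (auto simp: space_restrict_space)
    then have "Pair x \<in> Q x \<rightarrow>\<^sub>M borel_on (X \<times> Y)"
      using measurable_cong_sets[OF Qx refl] by blast
    ultimately show ?thesis
      using A by (simp add: emeasure_distr vimage_def Int_def conj_commute)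
  qed
  then show ?thesis
    unfolding joint_law_def
    by (subst emeasure_bind_prob_algebra[OF P joint_law_kernel[OF Q] A])
      (auto intro!: nn_integral_cong simp: sP)
qed

definition tv_dist :: "'a measure \<Rightarrow> 'a measure \<Rightarrow> real" where
  "tv_dist \<mu> \<nu> = 2 * (SUP B\<in>sets \<mu>. \<bar>measure \<mu> B - measure \<nu> B\<bar>)"

definition tv_continuous :: "'a::euclidean_space set \<Rightarrow> ('a \<Rightarrow> 'b measure) \<Rightarrow> bool" where
  "tv_continuous X Q \<longleftrightarrow>
    (\<forall>x\<in>X. \<forall>z. (\<forall>n. z n \<in> X) \<and> z \<longlonglongrightarrow> x \<longrightarrow> (\<lambda>n. tv_dist (Q (z n)) (Q x)) \<longlonglongrightarrow> 0)"

definition weakly_continuous ::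
    "'a::euclidean_space set \<Rightarrow> 'b::euclidean_space set \<Rightarrow> ('a \<Rightarrow> 'b measure) \<Rightarrow> bool" where
  "weakly_continuous X Y Q \<longleftrightarrow>
    (\<forall>g::'b \<Rightarrow> real. continuous_on Y g \<and> bounded (g ` Y) \<longrightarrow> continuous_on X (\<lambda>x. \<integral>y. g y \<partial>Q x))"

definition weak_conv_on ::
    "'a::euclidean_space set \<Rightarrow> (nat \<Rightarrow> 'a measure) \<Rightarrow> 'a measure \<Rightarrow> bool" where
  "weak_conv_on S \<mu>s \<mu> \<longleftrightarrow>
    (\<forall>g::'a \<Rightarrow> real. continuous_on S g \<and> bounded (g ` S) \<longrightarrow>
      (\<lambda>n. \<integral>x. g x \<partial>\<mu>s n) \<longlonglongrightarrow> (\<integral>x. g x \<partial>\<mu>))"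

text \<open>
  The empirical measure of the first \<open>n\<close> entries of a sample \<open>z\<close> (numbered from 0), as the image
  of the uniform distribution on the indices; \<open>S\<close> only supplies the sigma-algebra.
\<close>

definition empirical_measure :: "'a measure \<Rightarrow> (nat \<Rightarrow> 'a) \<Rightarrow> nat \<Rightarrow> 'a measure" where
  "empirical_measure S z n = distr (uniform_count_measure {..<n}) S z"

lemma measure_empirical_measure:
  assumes "B \<in> sets S" and z: "\<And>i. z i \<in> space S"
  shows "measure (empirical_measure S z n) B = 1 / real n * (\<Sum>i<n. indicator B (z i))"
proof -
  have "z \<in> uniform_count_measure {..<n} \<rightarrow>\<^sub>M S"
    using z by (auto simp: measurable_def space_uniform_count_measure sets_uniform_count_measure)
  moreover have "(\<Sum>i<n. indicator B (z i) :: real) = real (card (z -` B \<inter> {..<n}))"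
    by (simp add: indicator_def of_bool_def sum.If_cases Int_def vimage_def conj_commute)
  ultimately show ?thesis
    using assms by (simp add: empirical_measure_def measure_distr space_uniform_count_measure
        measure_uniform_count_measure)
qed

text \<open>
  In the next two definitions the suprema are taken in \<open>ennreal\<close>, so that they are \<open>\<infinity>\<close> when the
  deviations are unbounded (and 0 for the empty class).

  In the Glivenko-Cantelli property the i.i.d. sequence is the coordinate sequence of the infinite
  product of \<open>\<mu>\<close>; the property then holds for every i.i.d. sequence with law \<open>\<mu>\<close>, on any
  probability space. The supremum need not be measurable: \<open>AE\<close> means outside a null set.
\<close>

definition glivenko_cantelli :: "'a measure \<Rightarrow> ('a \<Rightarrow> real) set \<Rightarrow> bool" where
  "glivenko_cantelli \<mu> F \<longleftrightarrow>
    (\<forall>f\<in>F. integrable \<mu> f) \<and>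
    (AE z in Pi\<^sub>M UNIV (\<lambda>_::nat. \<mu>).
      (\<lambda>n. SUP f\<in>F. ennreal \<bar>(\<integral>x. f x \<partial>empirical_measure \<mu> z n) - (\<integral>x. f x \<partial>\<mu>)\<bar>) \<longlonglongrightarrow> 0)"

definition mu_uniformity_class ::
    "'a::euclidean_space set \<Rightarrow> 'a measure \<Rightarrow> ('a \<Rightarrow> real) set \<Rightarrow> bool" where
  "mu_uniformity_class S \<mu> F \<longleftrightarrow>
    (\<forall>f\<in>F. integrable \<mu> f) \<and>
    (\<forall>\<mu>s. (\<forall>n. \<mu>s n \<in> space (prob_algebra (borel_on S))) \<and> weak_conv_on S \<mu>s \<mu> \<longrightarrow>
      (\<lambda>n. SUP f\<in>F. ennreal \<bar>(\<integral>x. f x \<partial>\<mu>s n) - (\<integral>x. f x \<partial>\<mu>)\<bar>) \<longlonglongrightarrow> 0)"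

text \<open>
  The integrability condition says that the function \<open>x \<mapsto> \<integral>c(x, \<gamma>(y)) Q(dy|x)\<close> is well defined
  on \<open>X\<close>; it is needed because the Bochner integral of a non-integrable function is 0.
\<close>

definition gc_policies ::
    "'a::euclidean_space set \<Rightarrow> 'b::euclidean_space set \<Rightarrow> 'u::euclidean_space set \<Rightarrow>
      ('a \<times> 'u \<Rightarrow> real) \<Rightarrow> ('a \<Rightarrow> 'b measure) \<Rightarrow> ('a \<Rightarrow> real) set \<Rightarrow> ('b \<Rightarrow> 'u) set" where
  "gc_policies X Y U c Q E =
    {\<gamma> \<in> policies Y U.
      (\<forall>x\<in>X. integrable (Q x) (\<lambda>y. c (x, \<gamma> y))) \<and>
      (\<exists>f\<in>E. \<forall>x\<in>X. f x = (\<integral>y. c (x, \<gamma> y) \<partial>Q x))}"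

definition uniformity_policies ::
    "'a::euclidean_space set \<Rightarrow> 'b::euclidean_space set \<Rightarrow> 'u::euclidean_space set \<Rightarrow>
      ('a \<times> 'u \<Rightarrow> real) \<Rightarrow> ('a \<times> 'b \<Rightarrow> real) set \<Rightarrow> ('b \<Rightarrow> 'u) set" where
  "uniformity_policies X Y U c E =
    {\<gamma> \<in> policies Y U. \<exists>f\<in>E. \<forall>x\<in>X. \<forall>y\<in>Y. f (x, y) = c (x, \<gamma> y)}"

end

theory Submission
  imports Defs
begin

text \<open>
  If almost surely \<open>J(P\<^sub>n, Q, \<gamma>) \<rightarrow> J(P, Q, \<gamma>)\<close> uniformly over the policy class, then infima and costs of
  minimizers converge.

  Fix a countable base of the topology. Hoeffding's inequality and the Borel-Cantelli lemma give
  \<open>P\<^sub>n(A) \<rightarrow> P(A)\<close> almost surely for all sets \<open>A\<close> that are a base set minus finitely many others.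
  Outside this single null set, integrals converge uniformly over every uniformly bounded and
  equicontinuous class of functions, because \<open>X\<close> is partitioned by countably many such sets on which
  the whole class has small oscillation. Under (i) the functions \<open>x \<mapsto> \<integral>c(x, \<gamma>(y)) Q(dy|x)\<close> form such a
  class. Applied to single functions, the same fact is the weak convergence of the empirical measures.

  Under (iii) weak continuity of \<open>Q\<close> makes \<open>x \<mapsto> \<integral>g(x, y) Q(dy|x)\<close> continuous for bounded continuous
  \<open>g\<close> on the product, so \<open>P\<^sub>nQ\<close> converges weakly to \<open>PQ\<close> almost surely. The functions in a uniformity
  class are bounded, so that \<open>J(P\<^sub>n, Q, \<gamma>)\<close> is an integral over \<open>P\<^sub>nQ\<close>. Condition (ii) is a direct
  application of the Glivenko-Cantelli property to the law of the sample.
\<close>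

section \<open>Uniform convergence and infima\<close>

text \<open>Connects the \<open>ennreal\<close> suprema in \<open>glivenko_cantelli\<close> and
  \<open>mu_uniformity_class\<close> with \<open>uniform_limit\<close>, the form in which all
  further arguments run. A supremum below a finite \<open>e\<close> bounds each single
  deviation.\<close>

lemma uniform_limit_SUP_ennreal:
  fixes a :: "nat \<Rightarrow> 'i \<Rightarrow> real"
  assumes "(\<lambda>n. SUP i\<in>I. ennreal \<bar>a n i - b i\<bar>) \<longlonglongrightarrow> 0"
  shows "uniform_limit I a b sequentially"
proof (rule uniform_limitI)
  fix e :: real assume "e > 0"
  with assms have "\<forall>\<^sub>F n in sequentially. (SUP i\<in>I. ennreal \<bar>a n i - b i\<bar>) < ennreal e"
    by (intro order_tendstoD) auto
  then show "\<forall>\<^sub>F n in sequentially. \<forall>i\<in>I. dist (a n i) (b i) < e"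
  proof eventually_elim
    case (elim n)
    then have "ennreal \<bar>a n i - b i\<bar> < ennreal e" if "i \<in> I" for i
      using SUP_upper[OF that] le_less_trans by blast
    then show ?case
      by (auto simp: dist_real_def ennreal_less_iff)
  qed
qed

text \<open>A uniform error shifts an infimum by no more than that error. Arguing with order bounds
  in \<open>ereal\<close> covers infinite infima as well.\<close>

lemma tendsto_INF_ereal_uniform_limit:
  fixes a :: "'n \<Rightarrow> 'i \<Rightarrow> real"
  assumes "uniform_limit I a b F"
  shows "((\<lambda>n. INF i\<in>I. ereal (a n i)) \<longlongrightarrow> (INF i\<in>I. ereal (b i))) F"
proof (rule order_tendstoI)
  fix y assume "y < (INF i\<in>I. ereal (b i))"
  \<comment> \<open>The gap \<open>z2 - z1\<close> serves as the tolerance of the uniform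
    convergence, and \<open>z1\<close> is the bound that survives it.\<close>
  then obtain z1 z2 where z: "y < ereal z1" "z1 < z2" "ereal z2 < (INF i\<in>I. ereal (b i))"
    by (meson ereal_dense2 less_ereal.simps(1))
  from z(2) have "\<forall>\<^sub>F n in F. \<forall>i\<in>I. dist (a n i) (b i) < z2 - z1"
    by (intro uniform_limitD[OF assms]) simp
  then show "\<forall>\<^sub>F n in F. y < (INF i\<in>I. ereal (a n i))"
  proof eventually_elim
    case (elim n)
    have "z1 \<le> a n i" if "i \<in> I" for i
    proof -
      have "ereal z2 < ereal (b i)"
        using z(3) that by (metis INF_lower less_le_trans)
      then show ?thesis
        using elim that by (auto simp: dist_real_def abs_less_iff dest!: bspec[of I _ i])
    qed
    then have "ereal z1 \<le> (INF i\<in>I. ereal (a n i))"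
      by (intro INF_greatest) simp
    with z(1) show ?case by simp
  qed
next
  fix y assume "(INF i\<in>I. ereal (b i)) < y"
  then obtain z1 z2 where z: "(INF i\<in>I. ereal (b i)) < ereal z1" "z1 < z2" "ereal z2 < y"
    by (meson ereal_dense2 less_ereal.simps(1))
  then obtain i where i: "i \<in> I" "b i < z1"
    unfolding INF_less_iff by auto
  from z(2) have "\<forall>\<^sub>F n in F. \<forall>i\<in>I. dist (a n i) (b i) < z2 - z1"
    by (intro uniform_limitD[OF assms]) simp
  then show "\<forall>\<^sub>F n in F. (INF i\<in>I. ereal (a n i)) < y"
  proof eventually_elim
    case (elim n)
    then have "a n i < z2"
      using i by (auto simp: dist_real_def abs_less_iff dest!: bspec[of I _ i])
    then have "ereal (a n i) < y"
      using less_trans[OF _ z(3)] by simp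
    with i show ?case
      unfolding INF_less_iff by auto
  qed
qed

text \<open>Since \<open>a n (g n)\<close> equals the infimum, \<open>b (g n)\<close> is that
  infimum plus the error \<open>b (g n) - a n (g n)\<close>, which vanishes by uniformity even
  though \<open>g n\<close> varies. The error is real, so the sum in \<open>ereal\<close> is never
  indeterminate.\<close>

lemma tendsto_minimizers_uniform_limit:
  fixes a :: "'n \<Rightarrow> 'i \<Rightarrow> real"
  assumes lim: "uniform_limit I a b F"
    and opt: "\<forall>\<^sub>F n in F. g n \<in> I \<and> ereal (a n (g n)) = (INF i\<in>I. ereal (a n i))"
  shows "((\<lambda>n. ereal (b (g n))) \<longlongrightarrow> (INF i\<in>I. ereal (b i))) F"
proof -
  have "((\<lambda>n. b (g n) - a n (g n)) \<longlongrightarrow> 0) F"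
  proof (rule tendstoI)
    fix e :: real assume "e > 0"
    show "\<forall>\<^sub>F n in F. dist (b (g n) - a n (g n)) 0 < e"
      using uniform_limitD[OF lim \<open>e > 0\<close>] opt
      by eventually_elim (auto simp: dist_real_def abs_minus_commute)
  qed
  then have "((\<lambda>n. (INF i\<in>I. ereal (a n i)) + ereal (b (g n) - a n (g n)))
      \<longlongrightarrow> (INF i\<in>I. ereal (b i)) + ereal 0) F"
    by (intro tendsto_add_ereal_general tendsto_INF_ereal_uniform_limit[OF lim]) auto
  moreover have "\<forall>\<^sub>F n in F. (INF i\<in>I. ereal (a n i)) + ereal (b (g n) - a n (g n)) = ereal (b (g n))"
    using opt
  proof eventually_elim
    case (elim n)
    then have "(INF i\<in>I. ereal (a n i)) = ereal (a n (g n))" by simp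
    then show ?case by simp
  qed
  ultimately show ?thesis
    by (simp add: tendsto_cong zero_ereal_def[symmetric])
qed

section \<open>Empirical measures\<close>

lemma prob_algebra_borel_on:
  assumes "\<mu> \<in> space (prob_algebra (borel_on S))"
  shows "prob_space \<mu>" "sets \<mu> = sets (borel_on S)" "space \<mu> = S"
  using assms by (auto simp: space_prob_algebra space_restrict_space dest: sets_eq_imp_space_eq)

text \<open>The index starts at 1: for \<open>n = 0\<close> the uniform measure on the empty index
  set is zero and not a probability measure.\<close>

lemma empirical_measure_Suc_in_prob_algebra:
  assumes "\<And>i. z i \<in> space S"
  shows "empirical_measure S z (Suc n) \<in> space (prob_algebra S)"
proof -
  have "z \<in> uniform_count_measure {..<Suc n} \<rightarrow>\<^sub>M S"
    using assms by (auto simp: measurable_def space_uniform_count_measure sets_uniform_count_measure)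
  then show ?thesis
    unfolding empirical_measure_def space_prob_algebra
    by (auto intro!: prob_space.prob_space_distr prob_space_uniform_count_measure)
qed

text \<open>Strong law for the indicator of \<open>A\<close>. Hoeffding's inequality bounds the
  probability of a deviation by \<open>e\<close> by a geometric sequence in \<open>n\<close>, and
  Borel-Cantelli then excludes infinitely many such deviations.\<close>

lemma (in prob_space) AE_empirical_measure_tendsto:
  assumes indep: "indep_vars (\<lambda>_. S) Xs UNIV"
    and law: "\<And>i::nat. distr M S (Xs i) = P"
    and A: "A \<in> sets S"
  shows "AE \<omega> in M. (\<lambda>n. measure (empirical_measure S (\<lambda>i. Xs i \<omega>) n) A) \<longlonglongrightarrow> measure P A"
proof -
  have rv[measurable]: "random_variable S (Xs i)" for i
    using indep by (simp add: indep_vars_def)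
  define Z where "Z i \<omega> = (indicator A (Xs i \<omega>) :: real)" for i \<omega>
  define F where "F n \<omega> = (\<Sum>i<n. Z i \<omega>) / real n" for n \<omega>
  have Z[measurable]: "random_variable borel (Z i)" for i
    unfolding Z_def using A by measurable
  have F[measurable]: "random_variable borel (F n)" for n
    unfolding F_def by measurable
  have ind: "(indicator A :: _ \<Rightarrow> real) \<in> borel_measurable S"
    using A by simp
  have distr_Z: "distr M borel (Z i) = distr P borel (indicator A)" for i
    using law[of i] distr_distr[OF ind rv[of i]] by (simp add: comp_def Z_def[abs_def])
  have exp_Z: "expectation (Z 0) = measure P A"
  proof -
    have "expectation (Z 0) = integral\<^sup>L P (indicator A)"
      using integral_distr[OF rv[of 0] ind] law[of 0] by (simp add: Z_def[abs_def])
    also have "\<dots> = measure P A"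
      using A law[of 0] sets.sets_into_space[OF A] by (auto simp: Int_absorb2)
    finally show ?thesis .
  qed
  have bound: "prob {\<omega>\<in>space M. e \<le> \<bar>F n \<omega> - measure P A\<bar>} \<le> 2 * exp (- 2 * real n * e\<^sup>2)"
    if "n > 0" "e > 0" for n e
  proof -
    interpret Hoeffding_ineq_iid M "{..<n}" Z "Z 0" 0 1 "expectation (Z 0)"
    proof unfold_locales
      show "indep_vars (\<lambda>_. borel) Z {..<n}"
        unfolding Z_def
        by (rule indep_vars_compose2[OF indep_vars_subset[OF indep]]) (auto simp: ind)
    qed (auto simp: distr_Z, auto simp: Z_def)
    show ?thesis
      using Hoeffding_ineq_abs_ge'[of e] that by (simp add: exp_Z F_def lessThan_empty_iff)
  qed
  \<comment> \<open>Countably many tolerances \<open>1 / Suc k\<close> suffice, so one null set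
    serves all of them.\<close>
  have "AE \<omega> in M. \<forall>\<^sub>F n in sequentially. \<bar>F n \<omega> - measure P A\<bar> < 1 / real (Suc k)" for k
  proof -
    define e where "e = 1 / real (Suc k)"
    have e: "e > 0" by (simp add: e_def)
    have "summable (\<lambda>n. 2 * exp (- 2 * e\<^sup>2) ^ n)"
      using e by (intro summable_mult summable_geometric) simp
    then have "summable (\<lambda>n. prob {\<omega>\<in>space M. e \<le> \<bar>F n \<omega> - measure P A\<bar>})"
    proof (rule summable_comparison_test_ev[rotated])
      show "\<forall>\<^sub>F n in sequentially. norm (prob {\<omega>\<in>space M. e \<le> \<bar>F n \<omega> - measure P A\<bar>})
          \<le> 2 * exp (- 2 * e\<^sup>2) ^ n"
        using eventually_gt_at_top[of 0]
      proof eventually_elim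
        case (elim n)
        show ?case
          using bound[OF elim e] by (simp add: exp_of_nat_mult[symmetric] mult_ac)
      qed
    qed
    then have "AE \<omega> in M. \<forall>\<^sub>F n in sequentially.
        \<omega> \<in> space M - {\<omega>\<in>space M. e \<le> \<bar>F n \<omega> - measure P A\<bar>}"
      by (intro borel_cantelli_AE1) (auto simp: emeasure_eq_measure)
    then show ?thesis
      by eventually_elim (auto elim!: eventually_mono simp: e_def not_le)
  qed
  then have "AE \<omega> in M. \<forall>k. \<forall>\<^sub>F n in sequentially. \<bar>F n \<omega> - measure P A\<bar> < 1 / real (Suc k)"
    by (simp add: AE_all_countable)
  then show ?thesis
    using AE_space
  proof eventually_elim
    case (elim \<omega>)
    have "measure (empirical_measure S (\<lambda>i. Xs i \<omega>) n) A = F n \<omega>" for n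
      using measurable_space[OF rv] elim(2)
      by (subst measure_empirical_measure) (auto simp: A F_def Z_def)
    moreover have "(\<lambda>n. F n \<omega>) \<longlonglongrightarrow> measure P A"
    proof (rule tendstoI)
      fix e :: real assume "e > 0"
      then obtain k where "1 / real (Suc k) < e"
        using nat_approx_posE by blast
      then show "\<forall>\<^sub>F n in sequentially. dist (F n \<omega>) (measure P A) < e"
        using elim(1) by (auto simp: dist_real_def elim!: eventually_mono[OF spec[of _ k]])
    qed
    ultimately show ?case by simp
  qed
qed

text \<open>Each \<open>f\<close> is approximated by a step function on one countable partition of
  \<open>X\<close> on whose pieces all of \<open>F\<close> oscillates little. The partition depends
  on \<open>F\<close>, but its pieces are base sets minus finite unions of base sets, which is why
  \<open>lim\<close> has this form.\<close>

lemma uniform_limit_integral_equicontinuous: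
  fixes X :: "'a::topological_space set" and b :: "nat \<Rightarrow> 'a set" and F :: "('a \<Rightarrow> real) set"
  assumes basis: "topological_basis (range b)"
    and prob_n: "\<And>n. \<mu>s n \<in> space (prob_algebra (borel_on X))"
    and prob: "\<mu> \<in> space (prob_algebra (borel_on X))"
    and lim: "\<And>i J. finite J \<Longrightarrow> (\<lambda>n. measure (\<mu>s n) (X \<inter> (b i - \<Union>(b ` J))))
      \<longlonglongrightarrow> measure \<mu> (X \<inter> (b i - \<Union>(b ` J)))"
    and bounded: "\<And>f x. f \<in> F \<Longrightarrow> x \<in> X \<Longrightarrow> \<bar>f x\<bar> \<le> C"
    and equicont: "\<And>x e. x \<in> X \<Longrightarrow> e > 0 \<Longrightarrow>
      \<exists>V. open V \<and> x \<in> V \<and> (\<forall>f\<in>F. \<forall>y\<in>V \<inter> X. \<bar>f y - f x\<bar> \<le> e)"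
  shows "uniform_limit F (\<lambda>n f. \<integral>x. f x \<partial>\<mu>s n) (\<lambda>f. \<integral>x. f x \<partial>\<mu>) sequentially"
proof (rule uniform_limitI)
  fix e :: real assume "e > 0"
  \<comment> \<open>Positive whatever \<open>C\<close> is, so that one can divide by
    \<open>K\<close> below.\<close>
  define K where "K = \<bar>C\<bar> + 1"
  have "K > 0" by (simp add: K_def)
  have F_K: "\<bar>f x\<bar> \<le> K" if "f \<in> F" "x \<in> X" for f x
    using bounded[OF that] by (simp add: K_def)
  \<comment> \<open>The final estimate collects six errors of size \<open>d\<close>, so
    \<open>e / 8\<close> leaves room.\<close>
  define d where "d = e / 8"
  have "d > 0" using \<open>e > 0\<close> by (simp add: d_def)
  \<comment> \<open>Supplies the measurability of \<open>f\<close> in \<open>approx\<close>.\<close>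
  have F_cont: "continuous_on X f" if "f \<in> F" for f
    unfolding continuous_on_def
  proof (intro ballI tendstoI)
    fix x and r :: real assume x: "x \<in> X" and "r > 0"
    then obtain V where "open V" "x \<in> V" "\<forall>f\<in>F. \<forall>y\<in>V \<inter> X. \<bar>f y - f x\<bar> \<le> r / 2"
      using equicont[of x "r / 2"] by auto
    with \<open>r > 0\<close> that show "\<forall>\<^sub>F y in at x within X. dist (f y) (f x) < r"
      by (force simp: eventually_at_topological dist_real_def)
  qed
  have open_b: "open (b i)" for i
    using basis by (auto simp: topological_basis_open)
  \<comment> \<open>Basis sets of oscillation at most \<open>d\<close> for all of \<open>F\<close> at once; made disjoint, they partition
    \<open>X\<close>, and finitely many pieces carry almost all of the mass.\<close>
  define D where "D = {i. \<forall>f\<in>F. \<forall>y\<in>b i \<inter> X. \<forall>z\<in>b i \<inter> X. \<bar>f y - f z\<bar> \<le> d}"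
  have cover: "\<exists>i\<in>D. x \<in> b i" if x: "x \<in> X" for x
  proof -
    obtain V where V: "open V" "x \<in> V" "\<And>f y. f \<in> F \<Longrightarrow> y \<in> V \<inter> X \<Longrightarrow> \<bar>f y - f x\<bar> \<le> d / 2"
      using equicont[OF x, of "d / 2"] \<open>d > 0\<close> by auto
    then obtain i where i: "x \<in> b i" "b i \<subseteq> V"
      using topological_basisE[OF basis V(1,2)] by blast
    have "\<bar>f y - f z\<bar> \<le> d" if "f \<in> F" "y \<in> b i \<inter> X" "z \<in> b i \<inter> X" for f y z
    proof -
      have "\<bar>f y - f x\<bar> \<le> d / 2" "\<bar>f z - f x\<bar> \<le> d / 2"
        using V(3)[OF that(1), of y] V(3)[OF that(1), of z] that i by blast+
      then show ?thesis by linarith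
    qed
    with i(1) show ?thesis
      unfolding D_def by (intro bexI[of _ i] CollectI ballI)
  qed
  define A where "A i = (if i \<in> D then X \<inter> (b i - \<Union>(b ` (D \<inter> {..<i}))) else {})" for i
  have A_sets: "A i \<in> sets (borel_on X)" for i
  proof -
    have "b i - \<Union>(b ` (D \<inter> {..<i})) \<in> sets borel"
      using open_b by (intro sets.Diff sets.finite_UN) auto
    then show ?thesis by (auto simp: A_def sets_restrict_space)
  qed
  have disj: "i = j" if "x \<in> A i" "x \<in> A j" for x i j
    using that by (cases i j rule: linorder_cases) (auto simp: A_def split: if_splits)
  have Un: "(\<Union>i. A i) = X"
  proof
    show "X \<subseteq> (\<Union>i. A i)"
    proof
      fix x assume "x \<in> X"
      define i where "i = (LEAST i. i \<in> D \<and> x \<in> b i)"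
      have "i \<in> D \<and> x \<in> b i"
        unfolding i_def by (rule LeastI_ex) (use cover[OF \<open>x \<in> X\<close>] in blast)
      moreover have "x \<notin> b j" if "j \<in> D" "j < i" for j
        using not_less_Least[of j "\<lambda>i. i \<in> D \<and> x \<in> b i"] that by (auto simp: i_def)
      ultimately have "x \<in> A i"
        using \<open>x \<in> X\<close> by (auto simp: A_def)
      then show "x \<in> (\<Union>i. A i)" by blast
    qed
  qed (auto simp: A_def split: if_splits)
  \<comment> \<open>Each \<open>A i\<close> is empty or a set as in \<open>lim\<close> with
    \<open>J = D \<inter> {..<i}\<close>.\<close>
  have A_lim: "(\<lambda>n. measure (\<mu>s n) (A i)) \<longlonglongrightarrow> measure \<mu> (A i)" for i
    by (simp add: A_def lim)
  \<comment> \<open>Evaluation points for the step functions. Even for an empty piece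
    \<open>r i\<close> lies in \<open>X\<close>, so that \<open>F_K\<close> bounds
    \<open>f (r i)\<close> for every \<open>i\<close>.\<close>
  obtain r where r: "\<And>i. A i \<noteq> {} \<Longrightarrow> r i \<in> A i" "\<And>i. r i \<in> X"
  proof -
    have "X \<noteq> {}"
      using prob_algebra_borel_on[OF prob] prob_space.not_empty by metis
    then have "\<exists>x. (A i \<noteq> {} \<longrightarrow> x \<in> A i) \<and> x \<in> X" for i
      using Un by blast
    then show ?thesis using that by metis
  qed
  \<comment> \<open>The step function misses \<open>f\<close> by at most \<open>d\<close> on the
    first \<open>N\<close> pieces and by at most \<open>K\<close> elsewhere. The bound is the same
    for all \<open>f\<close>, and it is applied both to \<open>\<mu>s n\<close> and to
    \<open>\<mu>\<close>.\<close>
  have approx: "\<bar>(\<integral>x. f x \<partial>\<nu>) - (\<Sum>i<N. f (r i) * measure \<nu> (A i))\<bar>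
      \<le> d + K * (1 - (\<Sum>i<N. measure \<nu> (A i)))"
    if \<nu>: "\<nu> \<in> space (prob_algebra (borel_on X))" and f: "f \<in> F" for \<nu> f N
  proof -
    interpret prob_space \<nu> by (rule prob_algebra_borel_on[OF \<nu>])
    note S = prob_algebra_borel_on(2,3)[OF \<nu>]
    have A_sets': "A i \<in> sets \<nu>" for i
      using A_sets S by simp
    have "f \<in> borel_measurable \<nu>"
      using borel_measurable_continuous_on_restrict[OF F_cont[OF f]] S measurable_cong_sets by blast
    then have int_f: "integrable \<nu> f"
      using F_K[OF f] S by (intro integrable_const_bound[of _ K]) auto
    define s where "s x = (\<Sum>i<N. f (r i) * indicator (A i) x)" for x
    define u where "u x = (\<Sum>i<N. indicator (A i) x :: real)" for x
    have int_ind: "integrable \<nu> (indicator (A i) :: _ \<Rightarrow> real)" for i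
      using A_sets' by (simp add: integrable_indicator_iff emeasure_eq_measure)
    have int_s: "integrable \<nu> s"
      unfolding s_def by (intro Bochner_Integration.integrable_sum integrable_mult_right int_ind)
    have int_u: "integrable \<nu> u"
      unfolding u_def by (intro Bochner_Integration.integrable_sum int_ind)
    have "(\<integral>x. s x \<partial>\<nu>) = (\<Sum>i<N. \<integral>x. f (r i) * indicator (A i) x \<partial>\<nu>)"
      unfolding s_def
      by (intro Bochner_Integration.integral_sum integrable_mult_right int_ind)
    also have "\<dots> = (\<Sum>i<N. f (r i) * measure \<nu> (A i))"
      using A_sets' by simp
    finally have s: "(\<integral>x. s x \<partial>\<nu>) = (\<Sum>i<N. f (r i) * measure \<nu> (A i))" .
    have "(\<integral>x. u x \<partial>\<nu>) = (\<Sum>i<N. \<integral>x. indicator (A i) x \<partial>\<nu>)"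
      unfolding u_def by (intro Bochner_Integration.integral_sum int_ind)
    also have "\<dots> = (\<Sum>i<N. measure \<nu> (A i))"
      using A_sets' by simp
    finally have u: "(\<integral>x. u x \<partial>\<nu>) = (\<Sum>i<N. measure \<nu> (A i))" .
    have pw: "\<bar>f x - s x\<bar> \<le> d + K * (1 - u x)" if x: "x \<in> X" for x
    proof (cases "\<exists>j<N. x \<in> A j")
      case True
      then obtain j where j: "j < N" "x \<in> A j" by blast
      then have ind: "indicator (A i) x = (if i = j then 1 else 0 :: real)" for i
        using disj by (auto simp: indicator_def)
      have "s x = f (r j)" "u x = 1"
        using j by (simp_all add: s_def u_def ind if_distrib[of "(*) _"] cong: if_cong)
      moreover have "r j \<in> A j" using r(1) j by blast
      then have "\<bar>f x - f (r j)\<bar> \<le> d"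
        using j f by (auto simp: A_def D_def split: if_splits)
      ultimately show ?thesis by simp
    next
      case False
      then have "s x = 0" "u x = 0"
        by (auto simp: s_def u_def indicator_def)
      then show ?thesis
        using F_K[OF f x] \<open>d > 0\<close> by simp
    qed
    have "\<bar>(\<integral>x. f x \<partial>\<nu>) - (\<integral>x. s x \<partial>\<nu>)\<bar> = \<bar>\<integral>x. f x - s x \<partial>\<nu>\<bar>"
      using int_f int_s by simp
    also have "\<dots> \<le> (\<integral>x. \<bar>f x - s x\<bar> \<partial>\<nu>)"
      by (rule integral_abs_bound)
    also have "\<dots> \<le> (\<integral>x. d + K * (1 - u x) \<partial>\<nu>)"
      using int_f int_s int_u pw S by (intro integral_mono) auto
    also have "\<dots> = d + K * (1 - (\<integral>x. u x \<partial>\<nu>))"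
      using int_u by (simp add: prob_space)
    finally show ?thesis by (simp only: s u)
  qed
  obtain N where N: "1 - (\<Sum>i<N. measure \<mu> (A i)) < d / K"
  proof -
    interpret prob_space \<mu> by (rule prob_algebra_borel_on[OF prob])
    note S = prob_algebra_borel_on(2,3)[OF prob]
    have "(\<lambda>i. measure \<mu> (A i)) sums measure \<mu> (\<Union>i. A i)"
      using A_sets S disj by (intro finite_measure_UNION) (auto simp: disjoint_family_on_def)
    then have "(\<lambda>N. \<Sum>i<N. measure \<mu> (A i)) \<longlonglongrightarrow> 1"
      using Un S prob_space by (simp add: sums_def)
    then have "\<forall>\<^sub>F N in sequentially. 1 - d / K < (\<Sum>i<N. measure \<mu> (A i))"
      using \<open>d > 0\<close> \<open>K > 0\<close> by (intro order_tendstoD) auto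
    then show ?thesis
      using that by (auto simp: eventually_sequentially algebra_simps)
  qed
  have "(\<lambda>n. \<Sum>i<N. \<bar>measure (\<mu>s n) (A i) - measure \<mu> (A i)\<bar>) \<longlonglongrightarrow>
      (\<Sum>i<N. \<bar>measure \<mu> (A i) - measure \<mu> (A i)\<bar>)"
    by (intro tendsto_intros A_lim)
  then have "\<forall>\<^sub>F n in sequentially. (\<Sum>i<N. \<bar>measure (\<mu>s n) (A i) - measure \<mu> (A i)\<bar>) < d / K"
    using \<open>d > 0\<close> \<open>K > 0\<close> by (intro order_tendstoD) auto
  then show "\<forall>\<^sub>F n in sequentially. \<forall>f\<in>F. dist (\<integral>x. f x \<partial>\<mu>s n) (\<integral>x. f x \<partial>\<mu>) < e"
  proof eventually_elim
    case (elim n)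
    let ?m = "\<lambda>i. measure (\<mu>s n) (A i)" and ?m' = "\<lambda>i. measure \<mu> (A i)"
    let ?E = "\<Sum>i<N. \<bar>?m i - ?m' i\<bar>"
    show ?case
    proof
      fix f assume f: "f \<in> F"
      have "\<bar>(\<Sum>i<N. f (r i) * ?m i) - (\<Sum>i<N. f (r i) * ?m' i)\<bar>
          \<le> (\<Sum>i<N. \<bar>f (r i) * (?m i - ?m' i)\<bar>)"
        by (simp add: sum_subtractf[symmetric] right_diff_distrib[symmetric] sum_abs)
      also have "\<dots> \<le> K * ?E"
        unfolding sum_distrib_left abs_mult
        using F_K[OF f r(2)] by (intro sum_mono mult_right_mono) auto
      finally have 1: "\<bar>(\<Sum>i<N. f (r i) * ?m i) - (\<Sum>i<N. f (r i) * ?m' i)\<bar> \<le> K * ?E" .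
      \<comment> \<open>The mass that \<open>\<mu>s n\<close> puts outside the first
        \<open>N\<close> pieces is at most that of \<open>\<mu>\<close> plus the total error
        \<open>?E\<close> on these pieces.\<close>
      have "(\<Sum>i<N. ?m' i) - (\<Sum>i<N. ?m i) \<le> ?E"
        unfolding sum_subtractf[symmetric] by (intro sum_mono) auto
      then have "1 - (\<Sum>i<N. ?m i) \<le> ?E + (1 - (\<Sum>i<N. ?m' i))" by simp
      then have "K * (1 - (\<Sum>i<N. ?m i)) \<le> K * ?E + K * (1 - (\<Sum>i<N. ?m' i))"
        using \<open>K > 0\<close> by (metis distrib_left mult_le_cancel_left_pos)
      moreover have "K * ?E < d" "K * (1 - (\<Sum>i<N. ?m' i)) < d"
        using elim N \<open>K > 0\<close> by (simp_all add: pos_less_divide_eq mult.commute)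
      ultimately have "\<bar>(\<integral>x. f x \<partial>\<mu>s n) - (\<integral>x. f x \<partial>\<mu>)\<bar> < 8 * d"
        using approx[OF prob_n f, of n N] approx[OF prob f, of N] 1 \<open>d > 0\<close> by linarith
      then show "dist (\<integral>x. f x \<partial>\<mu>s n) (\<integral>x. f x \<partial>\<mu>) < e"
        by (simp add: dist_real_def d_def)
    qed
  qed
qed

section \<open>Channels continuous in total variation\<close>

text \<open>The integral of \<open>h\<close> is the integral, over the levels from 0 to
  \<open>C\<close>, of the masses of the superlevel sets. Each mass changes by at most half the
  total variation distance, hence the factor \<open>C / 2\<close>.\<close>

lemma abs_integral_diff_le_tv_dist:
  fixes h :: "'a \<Rightarrow> real"
  assumes \<mu>: "prob_space \<mu>" and \<nu>: "prob_space \<nu>" and sets: "sets \<nu> = sets \<mu>"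
    and h: "h \<in> borel_measurable \<mu>"
    and bounds: "\<And>x. x \<in> space \<mu> \<Longrightarrow> 0 \<le> h x" "\<And>x. x \<in> space \<mu> \<Longrightarrow> h x \<le> C"
  shows "\<bar>(\<integral>x. h x \<partial>\<mu>) - (\<integral>x. h x \<partial>\<nu>)\<bar> \<le> C / 2 * tv_dist \<mu> \<nu>"
proof -
  interpret \<mu>: prob_space \<mu> by fact
  interpret \<nu>: prob_space \<nu> by fact
  have space: "space \<nu> = space \<mu>" by (rule sets_eq_imp_space_eq[OF sets])
  note [measurable] = h
  obtain x0 where "x0 \<in> space \<mu>" using \<mu>.not_empty by blast
  then have "C \<ge> 0" using bounds[of x0] by linarith
  define t where "t = tv_dist \<mu> \<nu> / 2"
  have "bdd_above ((\<lambda>B. \<bar>measure \<mu> B - measure \<nu> B\<bar>) ` sets \<mu>)"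
  proof (rule bdd_aboveI2)
    show "\<bar>measure \<mu> B - measure \<nu> B\<bar> \<le> 1" for B
      using \<mu>.prob_le_1[of B] \<nu>.prob_le_1[of B] measure_nonneg[of \<mu> B] measure_nonneg[of \<nu> B]
      by linarith
  qed
  then have t: "\<bar>measure \<mu> B - measure \<nu> B\<bar> \<le> t" if "B \<in> sets \<mu>" for B
    using cSUP_upper[OF that] by (simp add: t_def tv_dist_def)
  have "\<bar>(\<integral>x. h x \<partial>\<mu>) - (\<integral>x. h x \<partial>\<nu>)\<bar> \<le> C * t + C / real k" if "k > 0" for k :: nat
  proof (cases "C = 0")
    \<comment> \<open>Treated apart because the levels are rescaled by dividing by
      \<open>C\<close>.\<close>
    case True
    then have "h x = 0" if "x \<in> space \<mu>" for x
      using bounds[OF that] by simp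
    then have "(\<integral>x. h x \<partial>\<mu>) = 0" "(\<integral>x. h x \<partial>\<nu>) = 0"
      using Bochner_Integration.integral_cong[of \<mu> \<mu> h "\<lambda>_. 0"]
        Bochner_Integration.integral_cong[of \<nu> \<nu> h "\<lambda>_. 0"] by (auto simp: space)
    with True show ?thesis by simp
  next
    case False
    with \<open>C \<ge> 0\<close> have "C > 0" by simp
    \<comment> \<open>Layer-cake discretization of \<open>h\<close> into \<open>k\<close> levels\<close>
    define B where "B j = {x \<in> space \<mu>. C * real j / real k \<le> h x}" for j
    have B: "B j \<in> sets \<mu>" for j
      unfolding B_def by measurable
    define s where "s x = C / real k * (\<Sum>j\<in>{1..k}. indicator (B j) x)" for x
    have s: "s x \<le> h x" "h x \<le> s x + C / real k" if x: "x \<in> space \<mu>" for x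
    proof -
      define u where "u = h x * real k / C"
      have u: "0 \<le> u" "u \<le> real k"
        using bounds[OF x] \<open>C > 0\<close> \<open>k > 0\<close> by (auto simp: u_def field_simps)
      have hu: "h x = C / real k * u"
        using \<open>C > 0\<close> \<open>k > 0\<close> by (simp add: u_def)
      have "(\<Sum>j\<in>{1..k}. indicator (B j) x) = (\<Sum>j\<in>{1..k}. if real j \<le> u then 1 else 0 :: real)"
        using x \<open>C > 0\<close> \<open>k > 0\<close> by (intro sum.cong) (auto simp: B_def indicator_def u_def field_simps)
      also have "\<dots> = real (card {j\<in>{1..k}. real j \<le> u})"
        by (simp add: sum.If_cases Int_def)
      \<comment> \<open>Hence \<open>s\<close> is \<open>h\<close> rounded down to a multiple of
        \<open>C / k\<close>.\<close>
      also have "{j\<in>{1..k}. real j \<le> u} = {1..nat \<lfloor>u\<rfloor>}"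
        using u by (auto simp: le_nat_iff le_floor_iff)
      finally have "s x = C / real k * of_int \<lfloor>u\<rfloor>"
        using u by (simp add: s_def)
      moreover have "C / real k * of_int \<lfloor>u\<rfloor> \<le> C / real k * u"
        "C / real k * u \<le> C / real k * (of_int \<lfloor>u\<rfloor> + 1)"
        using \<open>C > 0\<close> by (intro mult_left_mono; simp)+
      ultimately show "s x \<le> h x" "h x \<le> s x + C / real k"
        by (simp_all add: hu distrib_left)
    qed
    have int: "(\<integral>x. s x \<partial>\<rho>) \<le> (\<integral>x. h x \<partial>\<rho>) \<and> (\<integral>x. h x \<partial>\<rho>) \<le> (\<integral>x. s x \<partial>\<rho>) + C / real k \<and>
        (\<integral>x. s x \<partial>\<rho>) = C / real k * (\<Sum>j\<in>{1..k}. measure \<rho> (B j))"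
      if \<rho>: "prob_space \<rho>" "sets \<rho> = sets \<mu>" for \<rho>
    proof -
      interpret prob_space \<rho> by fact
      have space: "space \<rho> = space \<mu>" by (rule sets_eq_imp_space_eq[OF \<rho>(2)])
      have "h \<in> borel_measurable \<rho>"
        using h \<rho>(2) measurable_cong_sets by blast
      then have int_h: "integrable \<rho> h"
        using bounds by (intro integrable_const_bound[of _ C] AE_I2) (simp_all add: space)
      have int_B: "integrable \<rho> (indicator (B j) :: _ \<Rightarrow> real)" for j
        using B \<rho>(2) by (simp add: integrable_indicator_iff emeasure_eq_measure)
      then have int_s: "integrable \<rho> s" unfolding s_def
        by (intro integrable_mult_right Bochner_Integration.integrable_sum)
      have "(\<integral>x. h x \<partial>\<rho>) \<le> (\<integral>x. s x + C / real k \<partial>\<rho>)"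
        using int_h int_s s by (intro integral_mono) (auto simp: space)
      moreover have "(\<integral>x. s x \<partial>\<rho>) \<le> (\<integral>x. h x \<partial>\<rho>)"
        using int_h int_s s by (intro integral_mono) (auto simp: space)
      moreover have "(\<integral>x. s x \<partial>\<rho>) = C / real k * (\<Sum>j\<in>{1..k}. measure \<rho> (B j))"
        unfolding s_def using int_B B \<rho>(2)
        by (simp add: Bochner_Integration.integral_sum del: sum.cl_ivl_Suc)
      ultimately show ?thesis
        using int_s by (simp add: prob_space)
    qed
    have "\<bar>(\<Sum>j\<in>{1..k}. measure \<mu> (B j)) - (\<Sum>j\<in>{1..k}. measure \<nu> (B j))\<bar>
        \<le> (\<Sum>j\<in>{1..k}. \<bar>measure \<mu> (B j) - measure \<nu> (B j)\<bar>)"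
      by (simp add: sum_subtractf[symmetric] sum_abs)
    also have "\<dots> \<le> real k * t"
      using sum_bounded_above[of "{1..k}" "\<lambda>j. \<bar>measure \<mu> (B j) - measure \<nu> (B j)\<bar>" t] t[OF B] by simp
    finally have "C / real k * \<bar>(\<Sum>j\<in>{1..k}. measure \<mu> (B j)) - (\<Sum>j\<in>{1..k}. measure \<nu> (B j))\<bar>
        \<le> C / real k * (real k * t)"
      using \<open>C > 0\<close> by (intro mult_left_mono) auto
    moreover have "(\<integral>x. s x \<partial>\<mu>) - (\<integral>x. s x \<partial>\<nu>)
        = C / real k * ((\<Sum>j\<in>{1..k}. measure \<mu> (B j)) - (\<Sum>j\<in>{1..k}. measure \<nu> (B j)))"
      using int[OF \<mu> refl] int[OF \<nu> sets] by (simp only: right_diff_distrib)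
    ultimately have "\<bar>(\<integral>x. s x \<partial>\<mu>) - (\<integral>x. s x \<partial>\<nu>)\<bar> \<le> C * t"
      using \<open>C > 0\<close> \<open>k > 0\<close> by (simp only: abs_mult) simp
    with int[OF \<mu> refl] int[OF \<nu> sets] show ?thesis
      by linarith
  qed
  \<comment> \<open>The discretization error \<open>C / k\<close> disappears as \<open>k\<close>
    grows.\<close>
  then have "\<bar>(\<integral>x. h x \<partial>\<mu>) - (\<integral>x. h x \<partial>\<nu>)\<bar> \<le> C * t"
  proof (intro LIMSEQ_le_const[of "\<lambda>k. C * t + C / real k" "C * t"])
    show "(\<lambda>k. C * t + C / real k) \<longlonglongrightarrow> C * t"
      using tendsto_add[OF tendsto_const lim_const_over_n[of C]] by simp
  qed (auto intro!: exI[of _ 1])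
  then show ?thesis by (simp add: t_def)
qed

lemma channel_kernel:
  assumes "Q \<in> borel_on X \<rightarrow>\<^sub>M prob_algebra (borel_on Y)" and "x \<in> X"
  shows "Q x \<in> space (prob_algebra (borel_on Y))"
  using measurable_space[OF assms(1), of x] assms(2) by (simp add: space_restrict_space)

text \<open>The two integrals are compared through that of \<open>c (x, \<gamma> y)\<close> against
  \<open>Q x'\<close>. Changing the integrand costs little uniformly in the action, by compactness
  of \<open>U\<close>; changing the measure costs at most a multiple of the total variation
  distance. Neither bound depends on \<open>\<gamma>\<close>, so one \<open>V\<close> serves all
  policies.\<close>

lemma policy_cost_equicontinuous:
  fixes X :: "'a::euclidean_space set" and Y :: "'b::euclidean_space set"
    and U :: "'u::euclidean_space set" and c :: "'a \<times> 'u \<Rightarrow> real"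
  assumes Q: "Q \<in> borel_on X \<rightarrow>\<^sub>M prob_algebra (borel_on Y)"
    and c: "c \<in> borel_measurable (borel_on (X \<times> U))"
    and c_nonneg: "\<forall>z\<in>X \<times> U. 0 \<le> c z" and c_le: "\<forall>z\<in>X \<times> U. c z \<le> C"
    and c_cont: "continuous_on (X \<times> U) c" and U: "compact U"
    and tv: "tv_continuous X Q"
    and x: "x \<in> X" and e: "e > 0"
  shows "\<exists>V. open V \<and> x \<in> V \<and> (\<forall>\<gamma>\<in>policies Y U. \<forall>x'\<in>V \<inter> X.
    \<bar>(\<integral>y. c (x', \<gamma> y) \<partial>Q x') - (\<integral>y. c (x, \<gamma> y) \<partial>Q x)\<bar> \<le> e)"
proof -
  obtain V where V: "x \<in> V" "open V"
    "\<And>x' u. x' \<in> V \<inter> X \<Longrightarrow> u \<in> U \<Longrightarrow> dist (c (x', u)) (c (x, u)) \<le> e / 2"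
    using continuous_on_prod_compactE[OF c_cont U x, of "e / 2"] e by (metis half_gt_zero)
  have "((\<lambda>x'. tv_dist (Q x') (Q x)) \<longlongrightarrow> 0) (at x within X)"
    using tv x unfolding tv_continuous_def tendsto_at_iff_sequentially comp_def by blast
  \<comment> \<open>Multiplied by \<open>\<bar>C\<bar> / 2\<close>, this threshold is at most
    \<open>e / 2\<close>; the summand 1 avoids division by zero.\<close>
  then have "\<forall>\<^sub>F x' in at x within X. tv_dist (Q x') (Q x) < e / (\<bar>C\<bar> + 1)"
    using e by (intro order_tendstoD) auto
  then obtain W where W: "open W" "x \<in> W"
    "\<And>x'. x' \<in> W \<Longrightarrow> x' \<noteq> x \<Longrightarrow> x' \<in> X \<Longrightarrow> tv_dist (Q x') (Q x) < e / (\<bar>C\<bar> + 1)"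
    by (auto simp: eventually_at_topological)
  have "\<bar>(\<integral>y. c (x', \<gamma> y) \<partial>Q x') - (\<integral>y. c (x, \<gamma> y) \<partial>Q x)\<bar> \<le> e"
    if \<gamma>: "\<gamma> \<in> policies Y U" and x': "x' \<in> V \<inter> W \<inter> X" for \<gamma> x'
  proof (cases "x' = x")
    \<comment> \<open>The neighbourhood \<open>W\<close> controls only points other than
      \<open>x\<close>.\<close>
    case True
    then show ?thesis using e by simp
  next
    case False
    note Qx = prob_algebra_borel_on[OF channel_kernel[OF Q x]]
    have "x' \<in> X" using x' by simp
    note Qx' = prob_algebra_borel_on[OF channel_kernel[OF Q this]]
    interpret Q': prob_space "Q x'" by (rule Qx')
    have \<gamma>_U: "\<gamma> y \<in> U" if "y \<in> Y" for y
      using \<gamma> that by (auto simp: policies_def space_restrict_space dest: measurable_space)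
    have meas: "(\<lambda>y. c (z, \<gamma> y)) \<in> borel_measurable (borel_on Y)" if "z \<in> X" for z
    proof (rule measurable_compose[OF _ c])
      have "\<gamma> \<in> borel_on Y \<rightarrow>\<^sub>M borel"
        using \<gamma> by (simp add: policies_def measurable_restrict_space2_iff)
      then show "(\<lambda>y. (z, \<gamma> y)) \<in> borel_on Y \<rightarrow>\<^sub>M borel_on (X \<times> U)"
        using that \<gamma>_U by (intro measurable_restrict_space2 borel_measurable_Pair)
          (auto simp: space_restrict_space)
    qed
    have meas': "(\<lambda>y. c (z, \<gamma> y)) \<in> borel_measurable (Q x')" if "z \<in> X" for z
      using meas[OF that] Qx'(2) measurable_cong_sets by blast
    have int: "integrable (Q x') (\<lambda>y. c (z, \<gamma> y))" if "z \<in> X" for z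
      using c_nonneg c_le \<gamma>_U that Qx'(3) meas'[OF that]
      by (intro Q'.integrable_const_bound[of _ C]) auto
    have "\<bar>(\<integral>y. c (x', \<gamma> y) \<partial>Q x') - (\<integral>y. c (x, \<gamma> y) \<partial>Q x')\<bar>
        = \<bar>\<integral>y. c (x', \<gamma> y) - c (x, \<gamma> y) \<partial>Q x'\<bar>"
      using int x x' by simp
    also have "\<dots> \<le> (\<integral>y. \<bar>c (x', \<gamma> y) - c (x, \<gamma> y)\<bar> \<partial>Q x')"
      by (rule integral_abs_bound)
    also have "\<dots> \<le> (\<integral>y. e / 2 \<partial>Q x')"
      using int x x' V(3) \<gamma>_U Qx'(3) by (intro integral_mono) (auto simp: dist_real_def)
    finally have 1: "\<bar>(\<integral>y. c (x', \<gamma> y) \<partial>Q x') - (\<integral>y. c (x, \<gamma> y) \<partial>Q x')\<bar> \<le> e / 2"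
      by (simp add: Q'.prob_space)
    have "\<bar>(\<integral>y. c (x, \<gamma> y) \<partial>Q x') - (\<integral>y. c (x, \<gamma> y) \<partial>Q x)\<bar> \<le> \<bar>C\<bar> / 2 * tv_dist (Q x') (Q x)"
      using c_nonneg c_le \<gamma>_U x Qx'(3) Qx(2) Qx'(2) meas'[OF x]
      by (intro abs_integral_diff_le_tv_dist Qx(1) Qx'(1)) (auto intro: order_trans[OF _ abs_ge_self])
    also have "\<dots> \<le> \<bar>C\<bar> / 2 * (e / (\<bar>C\<bar> + 1))"
      using W(3)[of x'] x' False by (intro mult_left_mono) auto
    also have "\<dots> \<le> e / 2"
      using e by (simp add: field_simps)
    finally show ?thesis using 1 by linarith
  qed
  then show ?thesis
    using V(1,2) W(1,2) by (intro exI[of _ "V \<inter> W"]) auto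
qed

text \<open>For non-integrable \<open>f\<close> the Bochner integral is 0, and \<open>C\<close> is
  non-negative because the space is not empty, so the bound holds in this case too.\<close>

lemma (in prob_space) abs_expectation_le:
  fixes f :: "'a \<Rightarrow> real"
  assumes "\<And>x. x \<in> space M \<Longrightarrow> \<bar>f x\<bar> \<le> C"
  shows "\<bar>expectation f\<bar> \<le> C"
proof (cases "integrable M f")
  case True
  have "\<bar>expectation f\<bar> \<le> expectation (\<lambda>x. \<bar>f x\<bar>)"
    by (rule integral_abs_bound)
  also have "\<dots> \<le> expectation (\<lambda>x. C)"
    using True assms by (intro integral_mono) auto
  finally show ?thesis by (simp add: prob_space)
next
  case False
  obtain x where "x \<in> space M" using not_empty by blast
  then have "0 \<le> C" using assms[of x] by linarith
  then show ?thesis by (simp add: not_integrable_integral_eq[OF False])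
qed

section \<open>Weakly continuous channels\<close>

text \<open>Weak continuity speaks about integrands that do not depend on \<open>x\<close>. Near
  \<open>x0\<close>, therefore, \<open>g (x, y)\<close> is bounded below by a bounded Lipschitz
  function of \<open>y\<close> alone minus a small penalty. These minorants converge pointwise to
  \<open>g (x0, y)\<close>, so little is lost at \<open>x0\<close>.\<close>

lemma integral_kernel_lower_semicontinuous:
  fixes X :: "'a::euclidean_space set" and Y :: "'b::euclidean_space set" and g :: "'a \<times> 'b \<Rightarrow> real"
  assumes Q: "Q \<in> borel_on X \<rightarrow>\<^sub>M prob_algebra (borel_on Y)"
    and weak: "weakly_continuous X Y Q"
    and cont: "continuous_on (X \<times> Y) g"
    and bound: "\<And>z. z \<in> X \<times> Y \<Longrightarrow> \<bar>g z\<bar> \<le> C"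
    and x0: "x0 \<in> X" and l: "l < (\<integral>y. g (x0, y) \<partial>Q x0)"
  shows "\<forall>\<^sub>F x in at x0 within X. l < (\<integral>y. g (x, y) \<partial>Q x)"
proof -
  note Q_prob = prob_algebra_borel_on[OF channel_kernel[OF Q]]
  have meas: "f \<in> borel_measurable (Q x)" if "continuous_on Y f" "x \<in> X" for f :: "'b \<Rightarrow> real" and x
    using borel_measurable_continuous_on_restrict[OF that(1)] Q_prob(2)[OF that(2)]
      measurable_cong_sets by blast
  have g_cont: "continuous_on Y (\<lambda>y. g (x, y))" if "x \<in> X" for x
    using that by (intro continuous_on_compose2[OF cont] continuous_intros) auto
  have int_g: "integrable (Q x) (\<lambda>y. g (x, y))" if x: "x \<in> X" for x
  proof -
    interpret prob_space "Q x" by (rule Q_prob(1)[OF x])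
    show ?thesis
      using bound x meas[OF g_cont[OF x] x] Q_prob(3)[OF x]
      by (intro integrable_const_bound[of _ C]) auto
  qed
  obtain y0 where "y0 \<in> Y"
    using Q_prob(1,3)[OF x0] prob_space.not_empty by blast
  with x0 bound[of "(x0, y0)"] have "C \<ge> 0" by auto
  \<comment> \<open>A Lipschitz inf-convolution of \<open>g\<close> in both variables, frozen at \<open>x0\<close>: it removes the dependence
    of the integrand on \<open>x\<close> at the price of \<open>k * dist x x0\<close>.\<close>
  define \<phi> where "\<phi> k y = (INF p\<in>X \<times> Y. g p + real k * (dist (fst p) x0 + dist (snd p) y))" for k y
  have ne: "X \<times> Y \<noteq> {}" using x0 \<open>y0 \<in> Y\<close> by auto
  have bdd: "bdd_below ((\<lambda>p. g p + real k * (dist (fst p) x0 + dist (snd p) y)) ` (X \<times> Y))" for k y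
    using bound by (intro bdd_belowI2[of _ "- C"]) (force simp: abs_le_iff intro: add_increasing2)
  have \<phi>_le: "\<phi> k y \<le> g (x, y) + real k * dist x x0" if "x \<in> X" "y \<in> Y" for k x y
    using cINF_lower[OF bdd, of "(x, y)" k y] that by (simp add: \<phi>_def)
  have \<phi>_ge: "- C \<le> \<phi> k y" for k y
    unfolding \<phi>_def using bound
    by (intro cINF_greatest[OF ne]) (force simp: abs_le_iff intro: add_increasing2)
  have \<phi>_abs: "\<bar>\<phi> k y\<bar> \<le> C" if "y \<in> Y" for k y
    using \<phi>_ge[of k y] \<phi>_le[OF x0 that, of k] bound[of "(x0, y)"] x0 that by auto
  have \<phi>_lip: "\<phi> k y \<le> \<phi> k y' + real k * dist y y'" for k y y'
  proof -
    have "\<phi> k y - real k * dist y y' \<le> \<phi> k y'"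
      unfolding \<phi>_def[of k y']
    proof (rule cINF_greatest[OF ne])
      fix p assume p: "p \<in> X \<times> Y"
      have "\<phi> k y \<le> g p + real k * (dist (fst p) x0 + dist (snd p) y)"
        unfolding \<phi>_def by (rule cINF_lower[OF bdd p])
      also have "\<dots> \<le> g p + real k * (dist (fst p) x0 + dist (snd p) y' + dist y y')"
        using dist_triangle[of "snd p" y y'] by (intro add_left_mono mult_left_mono) (auto simp: dist_commute)
      finally show "\<phi> k y - real k * dist y y' \<le> g p + real k * (dist (fst p) x0 + dist (snd p) y')"
        by (simp add: algebra_simps)
    qed
    then show ?thesis by simp
  qed
  have \<phi>_cont: "continuous_on Y (\<phi> k)" for k
  proof (rule lipschitz_on_continuous_on)
    show "(real k)-lipschitz_on Y (\<phi> k)"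
    proof (rule lipschitz_onI)
      show "dist (\<phi> k y) (\<phi> k y') \<le> real k * dist y y'" for y y'
        using \<phi>_lip[of k y y'] \<phi>_lip[of k y' y] by (simp add: dist_real_def dist_commute abs_le_iff)
    qed simp
  qed
  have \<phi>_lim: "(\<lambda>k. \<phi> k y) \<longlonglongrightarrow> g (x0, y)" if y: "y \<in> Y" for y
  proof (rule tendstoI)
    fix r :: real assume "r > 0"
    have "(x0, y) \<in> X \<times> Y" using x0 y by simp
    then obtain d where d: "d > 0"
      "\<And>p. p \<in> X \<times> Y \<Longrightarrow> dist p (x0, y) < d \<Longrightarrow> dist (g p) (g (x0, y)) < r / 2"
      using cont[unfolded continuous_on_iff, rule_format, of "(x0, y)" "r / 2"] \<open>r > 0\<close> by auto
    \<comment> \<open>For \<open>k \<ge> k0\<close> the penalty at distance \<open>d\<close> or more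
      exceeds \<open>2 * C\<close>, the largest possible difference between values of
      \<open>g\<close>, so distant points cannot undercut \<open>g (x0, y)\<close>.\<close>
    obtain k0 :: nat where k0: "2 * C / d < real k0"
      using reals_Archimedean2 by blast
    have "dist (\<phi> k y) (g (x0, y)) < r" if "k \<ge> k0" for k
    proof -
      have "2 * C < real k0 * d"
        using k0 \<open>d > 0\<close> by (simp add: pos_divide_less_eq)
      also have "\<dots> \<le> real k * d"
        using that \<open>d > 0\<close> by (intro mult_right_mono) auto
      finally have k: "2 * C < real k * d" .
      have "g (x0, y) - r / 2 \<le> \<phi> k y"
        unfolding \<phi>_def
      proof (rule cINF_greatest[OF ne])
        fix p assume p: "p \<in> X \<times> Y"
        have dist_le: "dist p (x0, y) \<le> dist (fst p) x0 + dist (snd p) y"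
          by (simp add: dist_prod_def sqrt_sum_squares_le_sum)
        show "g (x0, y) - r / 2 \<le> g p + real k * (dist (fst p) x0 + dist (snd p) y)"
        proof (cases "dist p (x0, y) < d")
          case True
          then have "\<bar>g p - g (x0, y)\<bar> < r / 2"
            using d(2)[OF p] by (simp only: dist_real_def)
          then have "g (x0, y) - r / 2 \<le> g p"
            by linarith
          then show ?thesis by (auto intro: add_increasing2)
        next
          case False
          then have "real k * d \<le> real k * (dist (fst p) x0 + dist (snd p) y)"
            using dist_le by (intro mult_left_mono) auto
          then show ?thesis
            using k bound[OF p] bound[of "(x0, y)"] x0 y \<open>r > 0\<close> by auto
        qed
      qed
      moreover have "\<phi> k y \<le> g (x0, y)"
        using \<phi>_le[OF x0 y, of k] by simp
      ultimately show ?thesis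
        using \<open>r > 0\<close> by (auto simp: dist_real_def)
    qed
    then show "\<forall>\<^sub>F k in sequentially. dist (\<phi> k y) (g (x0, y)) < r"
      by (auto simp: eventually_sequentially)
  qed
  have int_\<phi>: "integrable (Q x) (\<phi> k)" if x: "x \<in> X" for x k
  proof -
    interpret prob_space "Q x" by (rule Q_prob(1)[OF x])
    show ?thesis
      using \<phi>_abs x meas[OF \<phi>_cont x] Q_prob(3)[OF x]
      by (intro integrable_const_bound[of _ C]) auto
  qed
  \<comment> \<open>By dominated convergence some \<open>k\<close> already keeps the integral at
    \<open>x0\<close> above \<open>l\<close>. For this fixed \<open>k\<close> the penalty
    \<open>k * dist x x0\<close> vanishes as \<open>x\<close> tends to \<open>x0\<close>.\<close>
  have "(\<lambda>k. \<integral>y. \<phi> k y \<partial>Q x0) \<longlonglongrightarrow> (\<integral>y. g (x0, y) \<partial>Q x0)"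
  proof (rule integral_dominated_convergence[where w = "\<lambda>_. C"])
    interpret prob_space "Q x0" by (rule Q_prob(1)[OF x0])
    show "integrable (Q x0) (\<lambda>_. C)" by simp
  qed (use \<phi>_lim \<phi>_abs meas[OF \<phi>_cont x0] meas[OF g_cont x0] Q_prob(3)[OF x0] x0 in auto)
  from order_tendstoD(1)[OF this l] obtain k where k: "l < (\<integral>y. \<phi> k y \<partial>Q x0)"
    by (auto simp: eventually_sequentially)
  have "bounded (\<phi> k ` Y)"
    using \<phi>_abs by (auto simp: bounded_iff)
  then have "continuous_on X (\<lambda>x. \<integral>y. \<phi> k y \<partial>Q x)"
    using weak \<phi>_cont unfolding weakly_continuous_def by blast
  then have "((\<lambda>x. (\<integral>y. \<phi> k y \<partial>Q x) - real k * dist x x0)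
      \<longlongrightarrow> (\<integral>y. \<phi> k y \<partial>Q x0) - real k * dist x0 x0) (at x0 within X)"
    using x0 by (intro tendsto_intros) (auto simp: continuous_on_def)
  then have "\<forall>\<^sub>F x in at x0 within X. l < (\<integral>y. \<phi> k y \<partial>Q x) - real k * dist x x0"
    using k by (intro order_tendstoD) auto
  moreover have "\<forall>\<^sub>F x in at x0 within X. x \<in> X"
    by (auto simp: eventually_at_filter)
  ultimately show ?thesis
  proof eventually_elim
    case (elim x)
    interpret prob_space "Q x" by (rule Q_prob(1)[OF elim(2)])
    have "(\<integral>y. \<phi> k y \<partial>Q x) \<le> (\<integral>y. g (x, y) + real k * dist x x0 \<partial>Q x)"
      using int_\<phi> int_g elim(2) \<phi>_le Q_prob(3) by (intro integral_mono) auto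
    also have "\<dots> = (\<integral>y. g (x, y) \<partial>Q x) + real k * dist x x0"
      using int_g[OF elim(2)] by (simp add: prob_space)
    finally show ?case using elim(1) by simp
  qed
qed

text \<open>Lower semicontinuity for \<open>g\<close> and for \<open>- g\<close>.\<close>

lemma continuous_on_integral_kernel:
  fixes X :: "'a::euclidean_space set" and Y :: "'b::euclidean_space set" and g :: "'a \<times> 'b \<Rightarrow> real"
  assumes Q: "Q \<in> borel_on X \<rightarrow>\<^sub>M prob_algebra (borel_on Y)"
    and weak: "weakly_continuous X Y Q"
    and cont: "continuous_on (X \<times> Y) g"
    and bound: "\<And>z. z \<in> X \<times> Y \<Longrightarrow> \<bar>g z\<bar> \<le> C"
  shows "continuous_on X (\<lambda>x. \<integral>y. g (x, y) \<partial>Q x)"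
  unfolding continuous_on_def
proof (intro ballI order_tendstoI)
  fix x0 l assume x0: "x0 \<in> X"
  show "\<forall>\<^sub>F x in at x0 within X. l < (\<integral>y. g (x, y) \<partial>Q x)" if "l < (\<integral>y. g (x0, y) \<partial>Q x0)"
    by (rule integral_kernel_lower_semicontinuous[OF Q weak cont bound x0 that])
  show "\<forall>\<^sub>F x in at x0 within X. (\<integral>y. g (x, y) \<partial>Q x) < l" if "(\<integral>y. g (x0, y) \<partial>Q x0) < l"
    using integral_kernel_lower_semicontinuous[OF Q weak continuous_on_minus[OF cont] _ x0, of C "- l"]
      bound that by simp
qed

section \<open>Uniformity classes\<close>

text \<open>For \<open>p\<close> between 0 and 1 this is the mixture of the point mass at
  \<open>z\<close> with weight \<open>p\<close> and of \<open>\<mu>\<close> with weight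
  \<open>1 - p\<close>, realized by a coin that selects either \<open>z\<close> or a draw from
  \<open>\<mu>\<close>. As an image of a product of probability measures it is a probability
  measure.\<close>

definition dirac_mixture :: "real \<Rightarrow> 'a \<Rightarrow> 'a measure \<Rightarrow> 'a measure" where
  "dirac_mixture p z \<mu> =
    distr (measure_pmf (bernoulli_pmf p) \<Otimes>\<^sub>M \<mu>) \<mu> (\<lambda>(b, x). if b then z else x)"

context
  fixes \<mu> :: "'a measure" and z :: 'a
  assumes \<mu>: "prob_space \<mu>" and z: "z \<in> space \<mu>"
begin

lemma measurable_dirac_mixture_map:
  "(\<lambda>(b, x). if b then z else x) \<in> measure_pmf (bernoulli_pmf p) \<Otimes>\<^sub>M \<mu> \<rightarrow>\<^sub>M \<mu>"
proof -
  have [measurable]: "fst \<in> measure_pmf (bernoulli_pmf p) \<Otimes>\<^sub>M \<mu> \<rightarrow>\<^sub>M count_space UNIV"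
    using measurable_fst[of "measure_pmf (bernoulli_pmf p)" \<mu>]
    by (simp cong: measurable_cong_sets)
  show ?thesis
    using z unfolding case_prod_unfold by measurable
qed

lemma prob_space_dirac_mixture: "prob_space (dirac_mixture p z \<mu>)"
proof -
  interpret pair_prob_space "measure_pmf (bernoulli_pmf p)" \<mu>
    by (intro pair_prob_space.intro pair_sigma_finite.intro prob_space_imp_sigma_finite \<mu>
        measure_pmf.prob_space_axioms)
  show ?thesis
    unfolding dirac_mixture_def by (rule P.prob_space_distr[OF measurable_dirac_mixture_map])
qed

lemma integral_dirac_mixture:
  fixes f :: "'a \<Rightarrow> real"
  assumes p: "0 \<le> p" "p \<le> 1" and f: "integrable \<mu> f"
  shows "(\<integral>x. f x \<partial>dirac_mixture p z \<mu>) = p * f z + (1 - p) * (\<integral>x. f x \<partial>\<mu>)"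
proof -
  let ?B = "measure_pmf (bernoulli_pmf p)"
  interpret \<mu>: prob_space \<mu> by (rule \<mu>)
  interpret pair_sigma_finite ?B \<mu>
    by (intro pair_sigma_finite.intro prob_space_imp_sigma_finite \<mu> measure_pmf.prob_space_axioms)
  let ?h = "\<lambda>(b, x). f (if b then z else x)"
  have f_meas: "f \<in> borel_measurable \<mu>" using f by simp
  have meas: "?h \<in> borel_measurable (?B \<Otimes>\<^sub>M \<mu>)"
    using measurable_compose[OF measurable_dirac_mixture_map f_meas] by (simp add: case_prod_unfold)
  have "integrable (?B \<Otimes>\<^sub>M \<mu>) ?h"
  proof (rule Fubini_integrable[OF meas])
    have "integrable \<mu> (\<lambda>x. ?h (b, x))" for b
      using f by (cases b) simp_all
    then show "AE b in ?B. integrable \<mu> (\<lambda>x. ?h (b, x))" by simp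
  qed (auto intro: integrable_measure_pmf_finite)
  then have "(\<integral>b. (\<integral>x. ?h (b, x) \<partial>\<mu>) \<partial>?B) = (\<integral>q. ?h q \<partial>(?B \<Otimes>\<^sub>M \<mu>))"
    by (rule integral_fst')
  moreover have "(\<integral>x. f x \<partial>dirac_mixture p z \<mu>) = (\<integral>q. ?h q \<partial>(?B \<Otimes>\<^sub>M \<mu>))"
    unfolding dirac_mixture_def
    by (subst integral_distr[OF measurable_dirac_mixture_map f_meas]) (simp add: case_prod_unfold)
  moreover have "(\<integral>b. (\<integral>x. ?h (b, x) \<partial>\<mu>) \<partial>?B) = p * f z + (1 - p) * (\<integral>x. f x \<partial>\<mu>)"
    using p by (simp add: integral_bernoulli_pmf \<mu>.prob_space)
  ultimately show ?thesis by simp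
qed

end

lemma mu_uniformity_class_bounded:
  fixes S :: "'a::euclidean_space set"
  assumes unif: "mu_uniformity_class S \<mu> F"
    and \<mu>: "\<mu> \<in> space (prob_algebra (borel_on S))"
    and f: "f \<in> F"
  obtains B where "\<And>x. x \<in> S \<Longrightarrow> \<bar>f x\<bar> \<le> B"
proof (rule ccontr)
  \<comment> \<open>If \<open>f\<close> were unbounded, then moving mass \<open>1 / n\<close> to points where \<open>\<bar>f\<bar>\<close> exceeds \<open>n\<close> would
    preserve the weak limit but not convergence of the integrals of \<open>f\<close>.\<close>
  assume "\<not> thesis"
  with that have unbounded: "\<exists>x\<in>S. B < \<bar>f x\<bar>" for B
    by (meson not_le)
  note S = prob_algebra_borel_on[OF \<mu>]
  interpret prob_space \<mu> by (rule S(1))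
  \<comment> \<open>The distance is taken from the mean because the mixture changes the integral by
    exactly \<open>p n\<close> times this difference.\<close>
  have "\<exists>z\<in>S. real (Suc n) < \<bar>f z - expectation f\<bar>" for n
  proof -
    obtain z where "z \<in> S" "real (Suc n) + \<bar>expectation f\<bar> < \<bar>f z\<bar>"
      using unbounded by blast
    then show ?thesis by (intro bexI[of _ z]) linarith+
  qed
  then obtain z where z: "\<And>n. z n \<in> S" "\<And>n. real (Suc n) < \<bar>f (z n) - expectation f\<bar>"
    by metis
  \<comment> \<open>With this weight the integral of \<open>f\<close> moves by more than 1 for every
    \<open>n\<close>, while that of a function bounded by \<open>B\<close> moves by at most
    \<open>2 * B / Suc n\<close>.\<close>
  define p where "p n = 1 / real (Suc n)" for n
  define \<mu>s where "\<mu>s n = dirac_mixture (p n) (z n) \<mu>" for n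
  have integral: "(\<integral>x. g x \<partial>\<mu>s n) - expectation g = p n * (g (z n) - expectation g)"
    if "integrable \<mu> g" for g :: "'a \<Rightarrow> real" and n
    using integral_dirac_mixture[OF S(1), of "z n" "p n" g] that z(1) S(3)
    by (simp add: \<mu>s_def p_def algebra_simps)
  have "\<mu>s n \<in> space (prob_algebra (borel_on S))" for n
    using prob_space_dirac_mixture[OF S(1), of "z n" "p n"] z(1) S(2,3)
    by (simp add: space_prob_algebra \<mu>s_def dirac_mixture_def)
  moreover have "weak_conv_on S \<mu>s \<mu>"
    unfolding weak_conv_on_def
  proof (intro allI impI, elim conjE)
    fix g :: "'a \<Rightarrow> real" assume g: "continuous_on S g" "bounded (g ` S)"
    then obtain B where B: "\<And>x. x \<in> S \<Longrightarrow> \<bar>g x\<bar> \<le> B"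
      by (auto simp: bounded_iff)
    have "g \<in> borel_measurable \<mu>"
      using borel_measurable_continuous_on_restrict[OF g(1)] S(2) measurable_cong_sets by blast
    then have int: "integrable \<mu> g"
      using B S(3) by (intro integrable_const_bound[of _ B]) auto
    have "\<bar>expectation g\<bar> \<le> B"
      using B S(3) by (intro abs_expectation_le) auto
    then have bnd: "\<bar>g (z n) - expectation g\<bar> \<le> 2 * B" for n
      using B[OF z(1)[of n]] by linarith
    have "(\<lambda>n. (\<integral>x. g x \<partial>\<mu>s n) - expectation g) \<longlonglongrightarrow> 0"
    proof (rule Lim_null_comparison)
      show "\<forall>\<^sub>F n in sequentially. norm ((\<integral>x. g x \<partial>\<mu>s n) - expectation g) \<le> p n * (2 * B)"
        using bnd by (intro always_eventually allI)
          (auto simp: integral[OF int] abs_mult p_def intro!: mult_left_mono divide_right_mono)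
      show "(\<lambda>n. p n * (2 * B)) \<longlonglongrightarrow> 0"
        unfolding p_def
        using tendsto_mult_right[OF LIMSEQ_Suc[OF lim_1_over_n], of "2 * B"] by simp
    qed
    then show "(\<lambda>n. \<integral>x. g x \<partial>\<mu>s n) \<longlonglongrightarrow> expectation g"
      by (simp add: LIM_zero_iff)
  qed
  ultimately have "uniform_limit F (\<lambda>n f. \<integral>x. f x \<partial>\<mu>s n) expectation sequentially"
    using unif unfolding mu_uniformity_class_def by (intro uniform_limit_SUP_ennreal) blast
  from uniform_limitD[OF this, of 1] f
  obtain n where "\<bar>(\<integral>x. f x \<partial>\<mu>s n) - expectation f\<bar> < 1"
    by (auto simp: dist_real_def eventually_sequentially)
  moreover have "integrable \<mu> f"
    using unif f by (simp add: mu_uniformity_class_def)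
  ultimately have "p n * \<bar>f (z n) - expectation f\<bar> < 1"
    by (simp add: integral abs_mult p_def)
  then have "\<bar>f (z n) - expectation f\<bar> < real (Suc n)"
    by (simp add: p_def field_simps)
  with z(2)[of n] show False by simp
qed

section \<open>Convergence of optimal costs\<close>

text \<open>Serves to skip the index 0, where the empirical measure is zero.\<close>

lemma uniform_limit_Suc:
  assumes "uniform_limit I (\<lambda>n. a (Suc n)) b sequentially"
  shows "uniform_limit I a b sequentially"
proof (rule uniform_limitI)
  fix e :: real assume "e > 0"
  from uniform_limitD[OF assms this]
  show "\<forall>\<^sub>F n in sequentially. \<forall>x\<in>I. dist (a n x) (b x) < e"
    by (simp only: eventually_sequentially_Suc[of "\<lambda>n. \<forall>x\<in>I. dist (a n x) (b x) < e"])
qed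

text \<open>Carries uniform convergence from a class of functions over to the policies that induce
  them; different policies may induce the same function.\<close>

lemma uniform_limit_reindex:
  assumes lim: "uniform_limit E a b F"
    and G: "\<And>g. g \<in> G \<Longrightarrow> \<exists>f\<in>E. (\<forall>n. a' n g = a n f) \<and> b' g = b f"
  shows "uniform_limit G a' b' F"
proof (rule uniform_limitI)
  fix e :: real assume "e > 0"
  show "\<forall>\<^sub>F n in F. \<forall>g\<in>G. dist (a' n g) (b' g) < e"
    using uniform_limitD[OF lim \<open>e > 0\<close>]
  proof eventually_elim
    case (elim n)
    show ?case
    proof
      fix g assume "g \<in> G"
      then obtain f where "f \<in> E" "a' n g = a n f" "b' g = b f" using G by blast
      with elim show "dist (a' n g) (b' g) < e" by simp
    qed
  qed
qed

text \<open>The quantifiers over \<open>F\<close> and \<open>C\<close> stand inside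
  \<open>AE\<close>: the exceptional set comes from the countably many sets \<open>?A i J\<close>,
  which are fixed before any class is chosen.\<close>

lemma (in prob_space) AE_uniform_limit_empirical_equicontinuous:
  fixes X :: "'b::second_countable_topology set"
  assumes P: "P \<in> space (prob_algebra (borel_on X))"
    and indep: "indep_vars (\<lambda>_. borel_on X) Xs UNIV"
    and law: "\<And>i::nat. distr M (borel_on X) (Xs i) = P"
  shows "AE \<omega> in M. \<forall>(F :: ('b \<Rightarrow> real) set) C.
    (\<forall>f\<in>F. \<forall>x\<in>X. \<bar>f x\<bar> \<le> C) \<longrightarrow>
    (\<forall>x\<in>X. \<forall>e>0. \<exists>V. open V \<and> x \<in> V \<and> (\<forall>f\<in>F. \<forall>y\<in>V \<inter> X. \<bar>f y - f x\<bar> \<le> e)) \<longrightarrow>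
    uniform_limit F (\<lambda>n f. \<integral>x. f x \<partial>empirical_measure (borel_on X) (\<lambda>i. Xs i \<omega>) n)
      (\<lambda>f. \<integral>x. f x \<partial>P) sequentially"
proof -
  obtain B :: "'b set set" where "countable B" and basis: "topological_basis B"
    using ex_countable_basis by blast
  \<comment> \<open>A non-empty countable base can be enumerated by all natural numbers, with
    repetitions if it is finite.\<close>
  moreover have "B \<noteq> {}"
    using topological_basisE[OF basis open_UNIV UNIV_I] by blast
  ultimately obtain b :: "nat \<Rightarrow> 'b set" where b: "topological_basis (range b)"
    by (metis range_from_nat_into)
  have open_b: "open (b i)" for i
    using b by (auto simp: topological_basis_open)
  have rv: "random_variable (borel_on X) (Xs i)" for i
    using indep by (simp add: indep_vars_def)
  let ?P = "\<lambda>\<omega> n. empirical_measure (borel_on X) (\<lambda>i. Xs i \<omega>) n"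
  let ?A = "\<lambda>i J. X \<inter> (b i - \<Union>(b ` J))"
  have "AE \<omega> in M. (\<lambda>n. measure (?P \<omega> n) (?A i J)) \<longlonglongrightarrow> measure P (?A i J)"
    if "J \<in> {J. finite J}" for i J
  proof (rule AE_empirical_measure_tendsto[OF indep law])
    have "b i - \<Union>(b ` J) \<in> sets borel"
      using open_b that by (intro sets.Diff sets.finite_UN) auto
    then show "?A i J \<in> sets (borel_on X)"
      by (auto simp: sets_restrict_space)
  qed
  then have "AE \<omega> in M. \<forall>i. \<forall>J\<in>{J. finite J}.
      (\<lambda>n. measure (?P \<omega> n) (?A i J)) \<longlonglongrightarrow> measure P (?A i J)"
    by (simp only: AE_all_countable AE_ball_countable[OF countable_Collect_finite]) blast
  then show ?thesis
    using AE_space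
  proof eventually_elim
    case (elim \<omega>)
    have "?P \<omega> (Suc n) \<in> space (prob_algebra (borel_on X))" for n
      using measurable_space[OF rv elim(2)] by (intro empirical_measure_Suc_in_prob_algebra)
    note prob_Suc = this
    have "uniform_limit F (\<lambda>n f. \<integral>x. f x \<partial>?P \<omega> (Suc n)) (\<lambda>f. \<integral>x. f x \<partial>P) sequentially"
      if "\<forall>f\<in>F. \<forall>x\<in>X. \<bar>f x\<bar> \<le> C"
        and "\<forall>x\<in>X. \<forall>e>0. \<exists>V. open V \<and> x \<in> V \<and> (\<forall>f\<in>F. \<forall>y\<in>V \<inter> X. \<bar>f y - f x\<bar> \<le> e)"
      for F :: "('b \<Rightarrow> real) set" and C
    proof (rule uniform_limit_integral_equicontinuous[OF b _ P])
      show "(\<lambda>n. measure (?P \<omega> (Suc n)) (?A i J)) \<longlonglongrightarrow> measure P (?A i J)" if "finite J" for i J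
        using LIMSEQ_Suc elim(1) that by blast
    qed (use that prob_Suc in auto)
    then show ?case
      by (intro allI impI uniform_limit_Suc[where a = "\<lambda>n f. \<integral>x. f x \<partial>?P \<omega> n"]) blast
  qed
qed

section \<open>The joint law of prior and channel\<close>

lemma joint_law_in_prob_algebra:
  fixes X :: "'a::euclidean_space set" and Y :: "'b::euclidean_space set"
  assumes P: "P \<in> space (prob_algebra (borel_on X))"
    and Q: "Q \<in> borel_on X \<rightarrow>\<^sub>M prob_algebra (borel_on Y)"
  shows "joint_law X Y P Q \<in> space (prob_algebra (borel_on (X \<times> Y)))"
  using prob_space_bind'[OF P joint_law_kernel[OF Q]] sets_bind'[OF P joint_law_kernel[OF Q]]
  by (simp add: joint_law_def space_prob_algebra)

text \<open>For bounded \<open>f\<close> and kernels of total mass at most 1, the integral over a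
  bind is an iterated integral. The inner one is transported along \<open>Pair x\<close>.\<close>

lemma integral_joint_law:
  fixes X :: "'a::euclidean_space set" and Y :: "'b::euclidean_space set" and f :: "'a \<times> 'b \<Rightarrow> real"
  assumes P: "P \<in> space (prob_algebra (borel_on X))"
    and Q: "Q \<in> borel_on X \<rightarrow>\<^sub>M prob_algebra (borel_on Y)"
    and f: "f \<in> borel_measurable (borel_on (X \<times> Y))"
    and bound: "\<And>z. z \<in> X \<times> Y \<Longrightarrow> \<bar>f z\<bar> \<le> B"
  shows "(\<integral>z. f z \<partial>joint_law X Y P Q) = (\<integral>x. (\<integral>y. f (x, y) \<partial>Q x) \<partial>P)"
proof -
  note P' = prob_algebra_borel_on[OF P]
  interpret prob_space P by (rule P'(1))
  let ?K = "\<lambda>x. distr (Q x) (borel_on (X \<times> Y)) (Pair x)"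
  have K: "?K \<in> P \<rightarrow>\<^sub>M prob_algebra (borel_on (X \<times> Y))"
    using joint_law_kernel[OF Q] P'(2) measurable_cong_sets by blast
  have "(\<integral>z. f z \<partial>joint_law X Y P Q) = (\<integral>x. (\<integral>z. f z \<partial>?K x) \<partial>P)"
    unfolding joint_law_def
  proof (rule integral_bind[OF f _ measurable_prob_algebraD[OF K] finite_measure_axioms])
    show "AE x in P. emeasure (?K x) (space (?K x)) \<le> ennreal 1"
    proof (rule AE_I2)
      fix x assume "x \<in> space P"
      then have "prob_space (?K x)"
        using measurable_space[OF K] by (auto simp: space_prob_algebra)
      then show "emeasure (?K x) (space (?K x)) \<le> ennreal 1"
        using prob_space.emeasure_space_1 by fastforce
    qed
  qed (use bound in \<open>auto simp: space_restrict_space\<close>)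
  also have "\<dots> = (\<integral>x. (\<integral>y. f (x, y) \<partial>Q x) \<partial>P)"
  proof (rule Bochner_Integration.integral_cong[OF refl])
    fix x assume "x \<in> space P"
    then have x: "x \<in> X" using P'(3) by simp
    have "Pair x \<in> borel_on Y \<rightarrow>\<^sub>M borel_on (X \<times> Y)"
      using x by (intro measurable_restrict_space2 measurable_restrict_space1)
        (auto simp: space_restrict_space)
    then have "Pair x \<in> Q x \<rightarrow>\<^sub>M borel_on (X \<times> Y)"
      using prob_algebra_borel_on(2)[OF channel_kernel[OF Q x]] measurable_cong_sets by blast
    then show "(\<integral>z. f z \<partial>?K x) = (\<integral>y. f (x, y) \<partial>Q x)"
      by (rule integral_distr[OF _ f])
  qed
  finally show ?thesis .
qed

lemma integrable_prob_algebra_borel_on_measurable: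
  fixes f :: "_ \<Rightarrow> real"
  assumes "\<mu> \<in> space (prob_algebra (borel_on S))" and "integrable \<mu> f"
  shows "f \<in> borel_measurable (borel_on S)"
  using borel_measurable_integrable[OF assms(2)]
    measurable_cong_sets[OF prob_algebra_borel_on(2)[OF assms(1)] refl] by blast

text \<open>Integrating a bounded continuous \<open>g\<close> over \<open>y\<close> first leaves a
  bounded continuous function of \<open>x\<close>, which is a test function for the convergence of
  the priors.\<close>

lemma weak_conv_on_joint_law:
  fixes X :: "'a::euclidean_space set" and Y :: "'b::euclidean_space set"
  assumes P: "P \<in> space (prob_algebra (borel_on X))"
    and Pn: "\<And>n. Pn n \<in> space (prob_algebra (borel_on X))"
    and Q: "Q \<in> borel_on X \<rightarrow>\<^sub>M prob_algebra (borel_on Y)"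
    and weak: "weakly_continuous X Y Q"
    and lim: "weak_conv_on X Pn P"
  shows "weak_conv_on (X \<times> Y) (\<lambda>n. joint_law X Y (Pn n) Q) (joint_law X Y P Q)"
  unfolding weak_conv_on_def
proof (intro allI impI, elim conjE)
  fix g :: "'a \<times> 'b \<Rightarrow> real" assume g: "continuous_on (X \<times> Y) g" "bounded (g ` (X \<times> Y))"
  then obtain B where B: "\<And>z. z \<in> X \<times> Y \<Longrightarrow> \<bar>g z\<bar> \<le> B"
    by (auto simp: bounded_iff)
  let ?h = "\<lambda>x. \<integral>y. g (x, y) \<partial>Q x"
  have "\<bar>?h x\<bar> \<le> B" if x: "x \<in> X" for x
  proof -
    interpret prob_space "Q x"
      by (rule prob_algebra_borel_on(1)[OF channel_kernel[OF Q x]])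
    show ?thesis
      using B x prob_algebra_borel_on(3)[OF channel_kernel[OF Q x]]
      by (intro abs_expectation_le) auto
  qed
  then have "bounded (?h ` X)"
    by (auto simp: bounded_iff)
  moreover have "continuous_on X ?h"
    by (rule continuous_on_integral_kernel[OF Q weak g(1) B])
  ultimately have "(\<lambda>n. \<integral>x. ?h x \<partial>Pn n) \<longlonglongrightarrow> (\<integral>x. ?h x \<partial>P)"
    using lim unfolding weak_conv_on_def by blast
  then show "(\<lambda>n. \<integral>z. g z \<partial>joint_law X Y (Pn n) Q) \<longlonglongrightarrow> (\<integral>z. g z \<partial>joint_law X Y P Q)"
    using integral_joint_law[OF Pn Q borel_measurable_continuous_on_restrict[OF g(1)] B]
      integral_joint_law[OF P Q borel_measurable_continuous_on_restrict[OF g(1)] B]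
    by simp
qed

text \<open>A single continuous function forms an equicontinuous class, and the null set is common
  to all classes, hence to all test functions.\<close>

lemma (in prob_space) AE_weak_conv_on_empirical:
  fixes X :: "'b::euclidean_space set"
  assumes P: "P \<in> space (prob_algebra (borel_on X))"
    and indep: "indep_vars (\<lambda>_. borel_on X) Xs UNIV"
    and law: "\<And>i::nat. distr M (borel_on X) (Xs i) = P"
  shows "AE \<omega> in M. weak_conv_on X (empirical_measure (borel_on X) (\<lambda>i. Xs i \<omega>)) P"
  using AE_uniform_limit_empirical_equicontinuous[OF assms]
proof eventually_elim
  case (elim \<omega>)
  show ?case
    unfolding weak_conv_on_def
  proof (intro allI impI, elim conjE)
    fix g :: "'b \<Rightarrow> real" assume g: "continuous_on X g" "bounded (g ` X)"
    from g(2) obtain C where C: "\<forall>x\<in>X. \<bar>g x\<bar> \<le> C"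
      by (auto simp: bounded_iff)
    have "\<exists>V. open V \<and> x \<in> V \<and> (\<forall>y\<in>V \<inter> X. \<bar>g y - g x\<bar> \<le> e)"
      if "x \<in> X" "e > 0" for x e
    proof -
      obtain d where "d > 0" "\<And>y. y \<in> X \<Longrightarrow> dist y x < d \<Longrightarrow> dist (g y) (g x) < e"
        using g(1) \<open>x \<in> X\<close> \<open>e > 0\<close> unfolding continuous_on_iff by blast
      then show ?thesis
        by (intro exI[of _ "ball x d"]) (auto simp: dist_commute dist_real_def intro!: less_imp_le)
    qed
    with C have "uniform_limit {g}
        (\<lambda>n f. \<integral>x. f x \<partial>empirical_measure (borel_on X) (\<lambda>i. Xs i \<omega>) n) (\<lambda>f. \<integral>x. f x \<partial>P) sequentially"
      by (intro elim[rule_format, of _ C]) auto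
    then show "(\<lambda>n. \<integral>x. g x \<partial>empirical_measure (borel_on X) (\<lambda>i. Xs i \<omega>) n) \<longlonglongrightarrow> (\<integral>x. g x \<partial>P)"
      by (rule tendsto_uniform_limitI) simp
  qed
qed

text \<open>By independence the law of the whole sample on sequence space is the infinite product of
  \<open>P\<close>, so the almost sure statement pulls back along the sample map.\<close>

lemma (in prob_space) AE_glivenko_cantelli_iid:
  assumes gc: "glivenko_cantelli P E"
    and indep: "indep_vars (\<lambda>_. S) Xs UNIV"
    and law: "\<And>i::nat. distr M S (Xs i) = P"
  shows "AE \<omega> in M. uniform_limit E (\<lambda>n f. \<integral>x. f x \<partial>empirical_measure S (\<lambda>i. Xs i \<omega>) n)
    (\<lambda>f. \<integral>x. f x \<partial>P) sequentially"
proof -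
  have rv: "random_variable S (Xs i)" for i
    using indep by (simp add: indep_vars_def)
  have "distr M (\<Pi>\<^sub>M i\<in>UNIV. S) (\<lambda>x. \<lambda>i\<in>UNIV. Xs i x) = (\<Pi>\<^sub>M i\<in>UNIV. distr M S (Xs i))"
    using indep rv by (subst (asm) indep_vars_iff_distr_eq_PiM) auto
  then have distr_Xs: "distr M (Pi\<^sub>M UNIV (\<lambda>_. S)) (\<lambda>x i. Xs i x) = Pi\<^sub>M UNIV (\<lambda>_::nat. P)"
    by (simp add: law restrict_def)
  have "(\<lambda>x i. Xs i x) \<in> M \<rightarrow>\<^sub>M Pi\<^sub>M UNIV (\<lambda>_. S)"
    using rv by (intro measurable_PiM_single') (auto simp: space_PiM intro: measurable_space[OF rv])
  then have "AE \<omega> in M. (\<lambda>n. SUP f\<in>E. ennreal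
      \<bar>(\<integral>x. f x \<partial>empirical_measure P (\<lambda>i. Xs i \<omega>) n) - (\<integral>x. f x \<partial>P)\<bar>) \<longlonglongrightarrow> 0"
    by (rule AE_distrD) (use gc in \<open>unfold glivenko_cantelli_def distr_Xs, blast\<close>)
  \<comment> \<open>Only the sigma-algebra of the first argument enters, and \<open>P\<close> and
    \<open>S\<close> share it.\<close>
  moreover have "empirical_measure P = empirical_measure S"
    using law[of 0] by (auto simp: empirical_measure_def fun_eq_iff intro!: distr_cong)
  ultimately show ?thesis
    by (auto elim!: eventually_mono intro!: uniform_limit_SUP_ennreal)
qed

section \<open>Almost sure convergence under each of the three conditions\<close>

theorem theorem4p1:
  fixes X :: "'a::euclidean_space set" and Y :: "'b::euclidean_space set"
    and U :: "'u::euclidean_space set"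
    and P :: "'a measure" and Q :: "'a \<Rightarrow> 'b measure"
    and c :: "'a \<times> 'u \<Rightarrow> real"
    and M :: "'w measure" and Xs :: "nat \<Rightarrow> 'w \<Rightarrow> 'a"
    and Pn :: "nat \<Rightarrow> 'w \<Rightarrow> 'a measure"
    and G :: "('b \<Rightarrow> 'u) set"
  assumes borel_sets: "X \<in> sets borel" "Y \<in> sets borel" "U \<in> sets borel"
    and prior: "P \<in> space (prob_algebra (borel_on X))"
    and channel: "Q \<in> borel_on X \<rightarrow>\<^sub>M prob_algebra (borel_on Y)"
    and cost_measurable: "c \<in> borel_measurable (borel_on (X \<times> U))"
    and prob_space: "prob_space M"
    and indep: "prob_space.indep_vars M (\<lambda>_. borel_on X) Xs UNIV"
    and law: "\<And>i. distr M (borel_on X) (Xs i) = P"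
    and Pn_def: "\<And>n \<omega>. Pn n \<omega> = empirical_measure (borel_on X) (\<lambda>i. Xs i \<omega>) n"
    and one_of:
      "((\<forall>z\<in>X \<times> U. 0 \<le> c z) \<and> bounded (c ` (X \<times> U)) \<and> continuous_on (X \<times> U) c \<and>
          compact U \<and> tv_continuous X Q \<and> G = policies Y U) \<or>
       (\<exists>E. glivenko_cantelli P E \<and> G = gc_policies X Y U c Q E) \<or>
       (\<exists>E. mu_uniformity_class (X \<times> Y) (joint_law X Y P Q) E \<and> weakly_continuous X Y Q \<and>
          G = uniformity_policies X Y U c E)"
  shows "(AE \<omega> in M. (\<lambda>n. opt_cost G c (Pn n \<omega>) Q) \<longlonglongrightarrow> opt_cost G c P Q) \<and>
    (\<forall>\<gamma>. (AE \<omega> in M. \<forall>n\<ge>1. optimal_policy G c (Pn n \<omega>) Q (\<gamma> n \<omega>)) \<longrightarrow>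
      (AE \<omega> in M. (\<lambda>n. ereal (cost c P Q (\<gamma> n \<omega>))) \<longlonglongrightarrow> opt_cost G c P Q))"
proof -
  interpret M: prob_space M by fact
  have rv: "Xs i \<in> M \<rightarrow>\<^sub>M borel_on X" for i
    using indep by (simp add: M.indep_vars_def)
  have Pn_space: "space (Pn n \<omega>) = X" for n \<omega>
    by (simp add: Pn_def empirical_measure_def space_restrict_space)
  have Pn_Suc: "Pn (Suc n) \<omega> \<in> space (prob_algebra (borel_on X))" if "\<omega> \<in> space M" for n \<omega>
    unfolding Pn_def using measurable_space[OF rv that]
    by (intro empirical_measure_Suc_in_prob_algebra)
  note P_space = prob_algebra_borel_on(3)[OF prior]
  \<comment> \<open>Both claims follow from this uniform convergence over \<open>G\<close>; the
    three conditions differ in how it is obtained.\<close>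
  have "AE \<omega> in M. uniform_limit G (\<lambda>n. cost c (Pn n \<omega>) Q) (cost c P Q) sequentially"
    using one_of
  proof (elim disjE exE conjE)
    assume nonneg: "\<forall>z\<in>X \<times> U. 0 \<le> c z" and "bounded (c ` (X \<times> U))"
      and cont: "continuous_on (X \<times> U) c" and U: "compact U" and tv: "tv_continuous X Q"
      and G: "G = policies Y U"
    then obtain C where C: "\<forall>z\<in>X \<times> U. \<bar>c z\<bar> \<le> C"
      by (auto simp: bounded_iff)
    then have C_le: "\<forall>z\<in>X \<times> U. c z \<le> C" by force
    let ?f = "\<lambda>\<gamma> x. \<integral>y. c (x, \<gamma> y) \<partial>Q x"
    show ?thesis
      using M.AE_uniform_limit_empirical_equicontinuous[OF prior indep law]
    proof eventually_elim
      case (elim \<omega>)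
      have "\<bar>?f \<gamma> x\<bar> \<le> C" if \<gamma>: "\<gamma> \<in> G" and x: "x \<in> X" for \<gamma> x
      proof -
        note Qx = prob_algebra_borel_on[OF channel_kernel[OF channel x]]
        interpret prob_space "Q x" by (rule Qx(1))
        show ?thesis
          using C x Qx(3) \<gamma> unfolding G policies_def
          by (intro abs_expectation_le) (auto simp: space_restrict_space dest: measurable_space)
      qed
      then have "\<forall>f\<in>?f ` G. \<forall>x\<in>X. \<bar>f x\<bar> \<le> C" by blast
      moreover have "\<forall>x\<in>X. \<forall>e>0. \<exists>V. open V \<and> x \<in> V \<and> (\<forall>f\<in>?f ` G. \<forall>y\<in>V \<inter> X. \<bar>f y - f x\<bar> \<le> e)"
      proof (intro ballI allI impI)
        fix x and e :: real assume "x \<in> X" "e > 0"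
        from policy_cost_equicontinuous[OF channel cost_measurable nonneg C_le cont U tv this]
        show "\<exists>V. open V \<and> x \<in> V \<and> (\<forall>f\<in>?f ` G. \<forall>y\<in>V \<inter> X. \<bar>f y - f x\<bar> \<le> e)"
          unfolding G by (elim exE conjE) (intro exI conjI; auto)
      qed
      ultimately have "uniform_limit (?f ` G) (\<lambda>n f. \<integral>x. f x \<partial>Pn n \<omega>) (\<lambda>f. \<integral>x. f x \<partial>P) sequentially"
        using elim unfolding Pn_def by blast
      then show ?case
        by (rule uniform_limit_reindex) (auto simp: cost_def)
    qed
  next
    fix E assume gc: "glivenko_cantelli P E" and G: "G = gc_policies X Y U c Q E"
    show ?thesis
      using M.AE_glivenko_cantelli_iid[OF gc indep law]
    proof eventually_elim
      case (elim \<omega>)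
      then show ?case
      proof (rule uniform_limit_reindex)
        fix \<gamma> assume "\<gamma> \<in> G"
        then obtain f where f: "f \<in> E" "\<And>x. x \<in> X \<Longrightarrow> f x = (\<integral>y. c (x, \<gamma> y) \<partial>Q x)"
          by (auto simp: G gc_policies_def)
        \<comment> \<open>The integrands agree on \<open>X\<close>, so the identity holds for every
          measure with this space, including the zero measure at \<open>n = 0\<close>.\<close>
        have "cost c \<mu> Q \<gamma> = (\<integral>x. f x \<partial>\<mu>)" if "space \<mu> = X" for \<mu>
          unfolding cost_def using f(2) that by (intro Bochner_Integration.integral_cong) auto
        with f(1) show "\<exists>f\<in>E. (\<forall>n. cost c (Pn n \<omega>) Q \<gamma>
            = (\<integral>x. f x \<partial>empirical_measure (borel_on X) (\<lambda>i. Xs i \<omega>) n)) \<and> cost c P Q \<gamma> = (\<integral>x. f x \<partial>P)"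
          using Pn_space P_space by (intro bexI[of _ f]) (simp_all add: Pn_def)
      qed
    qed
  next
    fix E assume unif: "mu_uniformity_class (X \<times> Y) (joint_law X Y P Q) E"
      and weak: "weakly_continuous X Y Q" and G: "G = uniformity_policies X Y U c E"
    show ?thesis
      using M.AE_weak_conv_on_empirical[OF prior indep law] AE_space
    proof eventually_elim
      case (elim \<omega>)
      \<comment> \<open>Shifted by one because a uniformity class is tested on sequences of
        probability measures.\<close>
      have "weak_conv_on X (\<lambda>n. Pn (Suc n) \<omega>) P"
        using elim(1) LIMSEQ_Suc unfolding weak_conv_on_def Pn_def by blast
      then have "weak_conv_on (X \<times> Y) (\<lambda>n. joint_law X Y (Pn (Suc n) \<omega>) Q) (joint_law X Y P Q)"
        by (intro weak_conv_on_joint_law prior Pn_Suc elim(2) channel weak)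
      then have "uniform_limit E (\<lambda>n f. \<integral>z. f z \<partial>joint_law X Y (Pn (Suc n) \<omega>) Q)
          (\<lambda>f. \<integral>z. f z \<partial>joint_law X Y P Q) sequentially"
        using unif joint_law_in_prob_algebra[OF Pn_Suc[OF elim(2)] channel]
        unfolding mu_uniformity_class_def
        by (intro uniform_limit_SUP_ennreal) (elim conjE allE impE; simp)
      then have "uniform_limit G (\<lambda>n. cost c (Pn (Suc n) \<omega>) Q) (cost c P Q) sequentially"
      proof (rule uniform_limit_reindex)
        fix \<gamma> assume "\<gamma> \<in> G"
        then obtain f where f: "f \<in> E" "\<And>x y. x \<in> X \<Longrightarrow> y \<in> Y \<Longrightarrow> f (x, y) = c (x, \<gamma> y)"
          by (auto simp: G uniformity_policies_def)
        note joint = joint_law_in_prob_algebra[OF prior channel]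
        have f_meas: "f \<in> borel_measurable (borel_on (X \<times> Y))"
          using unif f(1) unfolding mu_uniformity_class_def
          by (intro integrable_prob_algebra_borel_on_measurable[OF joint]) blast
        \<comment> \<open>Boundedness is derived at the true joint law, but it concerns
          \<open>f\<close> alone and so yields the cost identity for every prior, in particular for
          the empirical ones.\<close>
        obtain B where B: "\<And>z. z \<in> X \<times> Y \<Longrightarrow> \<bar>f z\<bar> \<le> B"
          using mu_uniformity_class_bounded[OF unif joint f(1)] by blast
        have "cost c \<mu> Q \<gamma> = (\<integral>z. f z \<partial>joint_law X Y \<mu> Q)"
          if \<mu>: "\<mu> \<in> space (prob_algebra (borel_on X))" for \<mu>
        proof -
          have "cost c \<mu> Q \<gamma> = (\<integral>x. (\<integral>y. f (x, y) \<partial>Q x) \<partial>\<mu>)"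
            unfolding cost_def
            using f(2) prob_algebra_borel_on(3)[OF \<mu>] prob_algebra_borel_on(3)[OF channel_kernel[OF channel]]
            by (intro Bochner_Integration.integral_cong) auto
          then show ?thesis
            using integral_joint_law[OF \<mu> channel f_meas B] by simp
        qed
        with f(1) show "\<exists>f\<in>E. (\<forall>n. cost c (Pn (Suc n) \<omega>) Q \<gamma>
            = (\<integral>z. f z \<partial>joint_law X Y (Pn (Suc n) \<omega>) Q)) \<and> cost c P Q \<gamma> = (\<integral>z. f z \<partial>joint_law X Y P Q)"
          using prior Pn_Suc[OF elim(2)] by (intro bexI[of _ f]) simp_all
      qed
      then show ?case
        by (rule uniform_limit_Suc[where a = "\<lambda>n. cost c (Pn n \<omega>) Q"])
    qed
  qed
  note lim = this
  show ?thesis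
  proof (intro conjI allI impI)
    show "AE \<omega> in M. (\<lambda>n. opt_cost G c (Pn n \<omega>) Q) \<longlonglongrightarrow> opt_cost G c P Q"
      using lim unfolding opt_cost_def
      by eventually_elim (rule tendsto_INF_ereal_uniform_limit)
    \<comment> \<open>The minimizers may depend on the sample in any way, since the convergence used
      is uniform over \<open>G\<close> for each fixed outcome.\<close>
    fix \<gamma> assume "AE \<omega> in M. \<forall>n\<ge>1. optimal_policy G c (Pn n \<omega>) Q (\<gamma> n \<omega>)"
    with lim show "AE \<omega> in M. (\<lambda>n. ereal (cost c P Q (\<gamma> n \<omega>))) \<longlonglongrightarrow> opt_cost G c P Q"
      unfolding opt_cost_def optimal_policy_def
    proof eventually_elim
      case (elim \<omega>)
      then show ?case
        by (intro tendsto_minimizers_uniform_limit) (auto simp: eventually_sequentially)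
    qed
  qed
qed

end
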